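(* Consider the constrained convex program and its standing assumptions (i)–(iv) described in the context, and assume further that: (a) $h=\mathrm{Ind}_{\mathcal{C}}$ where $\mathcal{C}$ is compact and $(\nu,q)$-uniformly convex for some $q\ge 2$ and $\nu>0$; (b) for some $\epsilon>0$, $\inf\{\|\nabla f(x)+\sum_{i=1}^m z_i\nabla g_i(x)\| : (x,z)\in\mathcal{A}_\epsilon,\ x\in\mathcal{C}\}>0$, with $\mathcal{A}_\epsilon$ as defined in the context. Let $\{(x^k,z^k)\}$ be generated by the algorithm described in the context with parameters satisfying: $\{\lambda_k\}$ positive and increasing, $\lambda_k=\Theta(k^{\tau})$ and $\lambda_{k+1}-\lambda_k=\mathcal{O}(k^{-(1-\tau)})$ for some $\tau\in(0,1)$; $\{\alpha_k\}\subset(0,1]$ nonincreasing with $\alpha_k=\Theta(k^{-p})$, $p\in(\tau,1)$; $\{\sigma_k\}$ positive with $\sigma_k\le\lambda_k$ and $\sigma_k=\Theta(k^{-(1+\gamma)})$ for some $\gamma>0$. Let $L^*$ be the optimal value of the program and $T_k:=[\mathcal{L}_{\lambda_k}(x^k,z^k)-L^*]_+$. Set $\mu:=1-2/q$ and $\omega:=\min\{p-\tau,1-p+\tau\}$. Then $$T_k=\begin{cases}\mathcal{O}\big(\frac{1}{k^{1-p+\tau}}\big) & \text{if }\mu=0,\\ \mathcal{O}\big(\max\big\{\frac{1}{k^{(1-\mu)\omega+p-\tau}},\frac{1}{k^{1-p+\tau}}\big\}\big) & \text{if }\mu\in(0,1).\end{cases}$$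
   Context: Conventions: $\|\cdot\|$ is the Euclidean norm, vector inequalities and maxima are componentwise, $[a]_+=\max\{a,0\}$ (componentwise for vectors), $\mathrm{dom}\,h=\{x:h(x)<\infty\}$, $\mathrm{Ind}_{\mathcal{C}}$ is the indicator function ($0$ on $\mathcal{C}$, $+\infty$ elsewhere). Asymptotic notation is as $k\to\infty$. Problem: $\min_{x\in\mathbb{R}^n} f(x)+h(x)$ subject to $g(x):=(g_1(x),\dots,g_m(x))^T\le 0$. Standing assumptions: (i) $f:\mathbb{R}^n\to\mathbb{R}$ is convex and differentiable with $L_f$-Lipschitz gradient, $L_f>0$. (ii) $h:\mathbb{R}^n\to(-\infty,+\infty]$ is proper, closed, convex, $\sup_{x,x'\in\mathrm{dom}\,h}\|x-x'\|\le D$ for some finite $D>0$, and for every $u\in\mathbb{R}^n$ the problem $\min_v\langle v,u\rangle+h(v)$ has a minimizer. (iii) Each $g_i:\mathbb{R}^n\to\mathbb{R}$ is convex and differentiable, and there is $L_{g_i}>0$ with $\|\nabla g_i(x)-\nabla g_i(x')\|\le L_{g_i}\|x-x'\|$ for all $x,x'\in\mathrm{dom}\,h$. (iv) There is a KKT point $(x^*,z^* )$: $0\in\nabla f(x^* )+\partial h(x^* )+\sum_{i=1}^m z_i^*\nabla g_i(x^* )$, $g(x^* )\le 0$, $z^*\ge 0$, $\langle z^*,g(x^* )\rangle=0$. Uniform convexity: a convex set $\mathcal{D}\subseteq\mathbb{R}^n$ is $(\nu,q)$-uniformly convex ($q\ge2$, $\nu>0$) if for all $x,y\in\mathcal{D}$,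 $t\in[0,1]$ and $w\in\mathbb{R}^n$ with $\|w\|=1$, one has $tx+(1-t)y+t(1-t)\nu\|x-y\|^q w\in\mathcal{D}$. For $\epsilon>0$: $\mathcal{A}_\epsilon=\{(x,z)\in\mathbb{R}^n\times\mathbb{R}^m_+ : g_i(x)\le\epsilon\ \forall i,\text{ and for every } i,\ g_i(x)<-\epsilon\text{ implies } z_i=0\}$. For $\lambda>0$, let $\Psi_\lambda(x,z)=\frac{\lambda}{2}\sum_{i=1}^m\big([g_i(x)+z_i/\lambda]_+^2-(z_i/\lambda)^2\big)$, $F_\lambda(x,z)=f(x)+\Psi_\lambda(x,z)$, and $\mathcal{L}_\lambda(x,z)=F_\lambda(x,z)+h(x)$ (augmented Lagrangian). Algorithm: choose $(x^0,z^0)\in\mathrm{dom}\,h\times\mathbb{R}^m_+$, a positive increasing sequence $\{\lambda_k\}$ ($\lambda_{k+1}>\lambda_k>0$) with $\lambda_k\to\infty$, a positive summable sequence $\{\sigma_k\}$ with $\sigma_k\le\lambda_k$, and stepsizes $\alpha_k\in[0,1]$. For $k=0,1,2,\dots$: $v^k\in\mathrm{Argmin}_{v}\ \langle\nabla_xF_{\lambda_k}(x^k,z^k),v\rangle+h(v)$ (any minimizer); $x^{k+1}=x^k+\alpha_k(v^k-x^k)$; $z^{k+1}=z^k+\sigma_k\max\{-z^k/\lambda_k,\ g(x^{k+1})\}$. *)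

theory Defs
  imports "HOL-Analysis.Analysis" "HOL-Library.Landau_Symbols"
begin

text \<open>The value is unspecified where \<open>f\<close> is not differentiable; see \<open>gderiv_gradient\<close>.\<close>

definition gradient :: "('a::euclidean_space \<Rightarrow> real) \<Rightarrow> 'a \<Rightarrow> 'a" where
  "gradient f x = (THE D. GDERIV f x :> D)"

lemma gradient_eqI:
  assumes "GDERIV f x :> D"
  shows "gradient f x = D"
  unfolding gradient_def
proof (rule the_equality[where P = "\<lambda>D. GDERIV f x :> D", OF assms])
  fix D' assume "GDERIV f x :> D'"
  then have "(\<lambda>h. h \<bullet> D') = (\<lambda>h. h \<bullet> D)"
    using assms unfolding gderiv_def by (rule has_derivative_unique)
  then show "D' = D"
    by (metis vector_eq_ldot)
qed

lemma gderiv_gradient: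
  assumes "f differentiable (at x)"
  shows "GDERIV f x :> gradient f x"
proof -
  obtain f' where f': "(f has_derivative f') (at x)"
    using assms unfolding differentiable_def by blast
  then have lin: "linear f'"
    by (rule has_derivative_linear)
  define D where "D = (\<Sum>b\<in>Basis. f' b *\<^sub>R b)"
  have "f' h = h \<bullet> D" for h
  proof -
    have "f' h = f' (\<Sum>b\<in>Basis. (h \<bullet> b) *\<^sub>R b)"
      by (simp add: euclidean_representation)
    also have "\<dots> = (\<Sum>b\<in>Basis. (h \<bullet> b) * f' b)"
      by (simp add: linear_sum[OF lin] linear_cmul[OF lin])
    also have "\<dots> = h \<bullet> D"
      by (simp add: D_def inner_sum_right mult.commute)
    finally show ?thesis .
  qed
  then have "f' = (\<lambda>h. h \<bullet> D)"
    by blast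
  then have "GDERIV f x :> D"
    using f' by (simp add: gderiv_def)
  then show ?thesis
    by (simp add: gradient_eqI)
qed


definition edom :: "('a \<Rightarrow> ereal) \<Rightarrow> 'a set" where
  "edom h = {x. h x < \<infinity>}"

definition epi :: "('a \<Rightarrow> ereal) \<Rightarrow> ('a \<times> real) set" where
  "epi h = {(x, r). h x \<le> ereal r}"

definition proper :: "('a \<Rightarrow> ereal) \<Rightarrow> bool" where
  "proper h \<longleftrightarrow> (\<forall>x. h x > -\<infinity>) \<and> edom h \<noteq> {}"

text \<open>For proper \<open>h\<close> this is empty outside \<open>edom h\<close>.\<close>

definition subdifferential :: "('a::real_inner \<Rightarrow> ereal) \<Rightarrow> 'a \<Rightarrow> 'a set" where
  "subdifferential h x = {s. \<forall>y. h y \<ge> h x + ereal (s \<bullet> (y - x))}"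

definition Ind :: "'a set \<Rightarrow> 'a \<Rightarrow> ereal" where
  "Ind C x = (if x \<in> C then 0 else \<infinity>)"

abbreviation minimizer :: "('a \<Rightarrow> ereal) \<Rightarrow> 'a \<Rightarrow> bool" where
  "minimizer \<phi> v \<equiv> is_arg_min \<phi> (\<lambda>_. True) v"

definition uniformly_convex_set :: "real \<Rightarrow> real \<Rightarrow> 'a::real_normed_vector set \<Rightarrow> bool" where
  "uniformly_convex_set \<nu> q C \<longleftrightarrow> convex C \<and>
     (\<forall>x\<in>C. \<forall>y\<in>C. \<forall>t\<in>{0..1}. \<forall>w. norm w = 1 \<longrightarrow>
        t *\<^sub>R x + (1 - t) *\<^sub>R y + (t * (1 - t) * \<nu> * norm (x - y) powr q) *\<^sub>R w \<in> C)"


definition kkt_point ::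
  "(real^'n \<Rightarrow> real) \<Rightarrow> (real^'n \<Rightarrow> ereal) \<Rightarrow> ('m::finite \<Rightarrow> real^'n \<Rightarrow> real) \<Rightarrow>
   real^'n \<Rightarrow> real^'m \<Rightarrow> bool" where
  "kkt_point f h g x z \<longleftrightarrow>
     0 \<in> (\<lambda>s. gradient f x + s + (\<Sum>i\<in>UNIV. (z $ i) *\<^sub>R gradient (g i) x)) ` subdifferential h x \<and>
     (\<forall>i. g i x \<le> 0) \<and> (\<forall>i. z $ i \<ge> 0) \<and> (\<Sum>i\<in>UNIV. z $ i * g i x) = 0"

text \<open>A closed convex \<open>h\<close> is one whose epigraph is closed and convex.\<close>

locale convex_program =
  fixes f :: "real^'n \<Rightarrow> real"
    and h :: "real^'n \<Rightarrow> ereal"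
    and g :: "'m::finite \<Rightarrow> real^'n \<Rightarrow> real"
    and Lf :: real and D :: real and Lg :: "'m \<Rightarrow> real"
  assumes f_convex: "convex_on UNIV f"
    and f_diff: "\<And>x. f differentiable (at x)"
    and Lf_pos: "Lf > 0"
    and f_smooth: "Lf-lipschitz_on UNIV (gradient f)"
    and h_proper: "proper h"
    and h_closed: "closed (epi h)"
    and h_convex: "convex (epi h)"
    and D_pos: "D > 0"
    and h_diam: "\<And>x x'. x \<in> edom h \<Longrightarrow> x' \<in> edom h \<Longrightarrow> norm (x - x') \<le> D"
    and h_lmo: "\<And>u. \<exists>v. minimizer (\<lambda>v. ereal (v \<bullet> u) + h v) v"
    and g_convex: "\<And>i. convex_on UNIV (g i)"
    and g_diff: "\<And>i x. g i differentiable (at x)"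
    and Lg_pos: "\<And>i. Lg i > 0"
    and g_smooth: "\<And>i. (Lg i)-lipschitz_on (edom h) (gradient (g i))"
    and kkt_exists: "\<exists>x z. kkt_point f h g x z"

definition opt_value ::
  "(real^'n \<Rightarrow> real) \<Rightarrow> (real^'n \<Rightarrow> ereal) \<Rightarrow> ('m \<Rightarrow> real^'n \<Rightarrow> real) \<Rightarrow> ereal" where
  "opt_value f h g = (INF x\<in>{x. \<forall>i. g i x \<le> 0}. ereal (f x) + h x)"

definition \<A> :: "('m::finite \<Rightarrow> real^'n \<Rightarrow> real) \<Rightarrow> real \<Rightarrow> ((real^'n) \<times> (real^'m)) set" where
  "\<A> g \<epsilon> = {(x, z). (\<forall>i. z $ i \<ge> 0) \<and> (\<forall>i. g i x \<le> \<epsilon>) \<and> (\<forall>i. g i x < - \<epsilon> \<longrightarrow> z $ i = 0)}"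


definition \<Psi> :: "('m::finite \<Rightarrow> real^'n \<Rightarrow> real) \<Rightarrow> real \<Rightarrow> real^'n \<Rightarrow> real^'m \<Rightarrow> real" where
  "\<Psi> g \<rho> x z = \<rho> / 2 * (\<Sum>i\<in>UNIV. (max (g i x + z $ i / \<rho>) 0)\<^sup>2 - (z $ i / \<rho>)\<^sup>2)"

definition F_AL ::
  "(real^'n \<Rightarrow> real) \<Rightarrow> ('m::finite \<Rightarrow> real^'n \<Rightarrow> real) \<Rightarrow> real \<Rightarrow> real^'n \<Rightarrow> real^'m \<Rightarrow> real" where
  "F_AL f g \<rho> x z = f x + \<Psi> g \<rho> x z"

definition aug_lagrangian ::
  "(real^'n \<Rightarrow> real) \<Rightarrow> (real^'n \<Rightarrow> ereal) \<Rightarrow> ('m::finite \<Rightarrow> real^'n \<Rightarrow> real) \<Rightarrow>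
   real \<Rightarrow> real^'n \<Rightarrow> real^'m \<Rightarrow> ereal" where
  "aug_lagrangian f h g \<rho> x z = ereal (F_AL f g \<rho> x z) + h x"

locale fw_alm =
  fixes f :: "real^'n \<Rightarrow> real"
    and h :: "real^'n \<Rightarrow> ereal"
    and g :: "'m::finite \<Rightarrow> real^'n \<Rightarrow> real"
    and lam \<sigma> \<alpha> :: "nat \<Rightarrow> real"
    and x v :: "nat \<Rightarrow> real^'n"
    and z :: "nat \<Rightarrow> real^'m"
  assumes x0: "x 0 \<in> edom h"
    and z0: "\<And>i. z 0 $ i \<ge> 0"
    and lam_pos: "\<And>k. lam k > 0"
    and lam_strict_mono: "strict_mono lam"
    and lam_at_top: "filterlim lam at_top sequentially"
    and \<sigma>_pos: "\<And>k. \<sigma> k > 0"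
    and \<sigma>_summable: "summable \<sigma>"
    and \<sigma>_le_lam: "\<And>k. \<sigma> k \<le> lam k"
    and \<alpha>_range: "\<And>k. \<alpha> k \<in> {0..1}"
    and v_step: "\<And>k. minimizer (\<lambda>w. ereal (gradient (\<lambda>y. F_AL f g (lam k) y (z k)) (x k) \<bullet> w) + h w) (v k)"
    and x_step: "\<And>k. x (Suc k) = x k + \<alpha> k *\<^sub>R (v k - x k)"
    and z_step: "\<And>k. z (Suc k) = z k + \<sigma> k *\<^sub>R (\<chi> i. max (- (z k $ i / lam k)) (g i (x (Suc k))))"

end

theory Submission
  imports Defs
begin

text \<open>
  Write \<open>r = max (g x) (- z / \<lambda>)\<close>. The penalty \<open>\<Psi>\<close> equals \<open>\<lambda>/2 |r|^2 + \<langle>r, z\<rangle>\<close>, and this is a minimum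
  over all \<open>r \<ge> g x\<close>; hence updating \<open>\<lambda>\<close> and \<open>z\<close> raises the augmented Lagrangian by at most
  \<open>((\<lambda>' - \<lambda>)/2 + \<sigma>) |r|^2\<close>, while the KKT multiplier bounds \<open>|r|^2\<close> by
  \<open>4/\<lambda> (\<L> - L + O(1/\<lambda>))\<close>. Both updates thus cost \<open>O(1/k) T + O(k^(-1-\<tau>))\<close>, which is negligible
  against the Frank--Wolfe decrease \<open>\<alpha> gap\<close>, where \<open>gap \<ge> T\<close>. It remains to absorb the curvature
  term \<open>M \<lambda> \<alpha>^2 |v - x|^2\<close>. Bounding \<open>|v - x|\<close> by the diameter shows that \<open>T\<close> is bounded, so \<open>r\<close>
  tends to \<open>0\<close> and the gradient of the augmented Lagrangian stays away from \<open>0\<close>; uniform convexity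
  then gives \<open>gap \<ge> \<kappa> |v - x|^q\<close>, and Young's inequality turns the curvature term into
  \<open>\<alpha> gap/2 + O(\<alpha> k^(-(p-\<tau>)/\<mu>))\<close>. The exponent \<open>(p - \<tau>)/\<mu>\<close> is at least
  \<open>(2 - \<mu>)(p - \<tau>) \<ge> (1 - \<mu>) \<omega> + p - \<tau>\<close>.
\<close>

subsection \<open>Convexity and the squared positive part\<close>

text \<open>Convexity passes to the restriction \<open>\<phi>\<close> of \<open>f\<close> to the
  line through \<open>x\<close> and \<open>y\<close>, whose slope at 0 is the directional
  derivative, so the one-variable tangent inequality applies.\<close>

lemma convex_gradient_ineq:
  assumes "convex_on UNIV f" and "f differentiable (at x)"
  shows "f x + gradient f x \<bullet> (y - x) \<le> f y"
proof -
  define \<phi> where "\<phi> = (\<lambda>t::real. f (x + t *\<^sub>R (y - x)))"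
  have conv: "convex_on UNIV \<phi>"
  proof (rule convex_onI)
    fix t a b :: real
    assume t: "0 < t" "t < 1"
    have "x + ((1 - t) *\<^sub>R a + t *\<^sub>R b) *\<^sub>R (y - x)
        = (1 - t) *\<^sub>R (x + a *\<^sub>R (y - x)) + t *\<^sub>R (x + b *\<^sub>R (y - x))"
      by (simp add: algebra_simps)
    then show "\<phi> ((1 - t) *\<^sub>R a + t *\<^sub>R b) \<le> (1 - t) * \<phi> a + t * \<phi> b"
      unfolding \<phi>_def using convex_onD[OF assms(1)] t by simp
  qed auto
  have "(f has_derivative (\<lambda>h. h \<bullet> gradient f x)) (at (x + 0 *\<^sub>R (y - x)))"
    using gderiv_gradient[OF assms(2)] by (simp add: gderiv_def)
  moreover have "((\<lambda>t. x + t *\<^sub>R (y - x)) has_derivative (\<lambda>t. t *\<^sub>R (y - x))) (at 0)"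
    by (auto intro!: derivative_eq_intros)
  ultimately have "(\<phi> has_derivative (\<lambda>t. (t *\<^sub>R (y - x)) \<bullet> gradient f x)) (at 0)"
    unfolding \<phi>_def by (rule has_derivative_compose[rotated])
  then have "(\<phi> has_real_derivative (gradient f x \<bullet> (y - x))) (at 0)"
    by (simp add: has_field_derivative_def inner_commute mult_commute_abs)
  with conv have "\<phi> 1 - \<phi> 0 \<ge> (gradient f x \<bullet> (y - x)) * (1 - 0)"
    by (intro convex_on_imp_above_tangent[where A = UNIV]) auto
  then show ?thesis by (simp add: \<phi>_def)
qed

text \<open>Only the case \<open>a \<ge> 0 > b\<close> sees the kink: there the left side is
  \<open>2 * a * b - a^2\<close>, which is at most 0. For nonnegative \<open>a\<close> and
  \<open>b\<close> the claim is \<open>(a - b)^2 \<ge> 0\<close>.\<close>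

lemma pos_part_sq_above_tangent:
  fixes a b :: real
  shows "(max a 0)\<^sup>2 + 2 * max a 0 * (b - a) \<le> (max b 0)\<^sup>2"
proof (cases "a \<ge> 0 \<and> b < 0")
  case True
  then have "a * b \<le> 0" by (simp add: mult_nonneg_nonpos)
  with True show ?thesis
    by (simp add: max_def power2_eq_square algebra_simps)
next
  case False
  then show ?thesis
    using sum_squares_ge_zero[of "a - b" 0]
    by (auto simp add: max_def power2_eq_square algebra_simps)
qed

text \<open>The right side is the square of \<open>max a 0 + (b - a)\<close>, and this number
  dominates \<open>max b 0\<close> in absolute value because \<open>max a 0 \<ge> a\<close>.\<close>

lemma pos_part_sq_tangent_error:
  fixes a b :: real
  shows "(max b 0)\<^sup>2 \<le> (max a 0)\<^sup>2 + 2 * max a 0 * (b - a) + (b - a)\<^sup>2"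
proof -
  have "(max a 0)\<^sup>2 + 2 * max a 0 * (b - a) + (b - a)\<^sup>2 = (max a 0 + (b - a))\<^sup>2"
    by (simp add: power2_eq_square algebra_simps)
  moreover have "(max b 0)\<^sup>2 \<le> (max a 0 + (b - a))\<^sup>2"
    by (rule abs_le_square_iff[THEN iffD1]) (simp add: max_def abs_if)
  ultimately show ?thesis by simp
qed

text \<open>The two preceding bounds confine the first-order remainder to the interval from 0 to
  \<open>h^2\<close>, also at the kink.\<close>

lemma DERIV_pos_part_sq: "((\<lambda>t::real. (max t 0)\<^sup>2) has_real_derivative 2 * max a 0) (at a)"
  unfolding DERIV_def
proof (rule LIM_zero_cancel, rule Lim_null_comparison)
  show "\<forall>\<^sub>F h in at 0. norm (((max (a + h) 0)\<^sup>2 - (max a 0)\<^sup>2) / h - 2 * max a 0) \<le> \<bar>h\<bar>"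
  proof (rule eventually_mono[OF eventually_neq_at_within[of 0]])
    fix h :: real
    assume h: "h \<noteq> 0"
    have "\<bar>(max (a + h) 0)\<^sup>2 - (max a 0)\<^sup>2 - 2 * max a 0 * h\<bar> \<le> \<bar>h\<bar> * \<bar>h\<bar>"
      using pos_part_sq_above_tangent[of a "a + h"] pos_part_sq_tangent_error[of "a + h" a]
      by (simp add: power2_eq_square)
    moreover have "((max (a + h) 0)\<^sup>2 - (max a 0)\<^sup>2) / h - 2 * max a 0
        = ((max (a + h) 0)\<^sup>2 - (max a 0)\<^sup>2 - 2 * max a 0 * h) / h"
      using h by (simp add: field_simps)
    ultimately show "norm (((max (a + h) 0)\<^sup>2 - (max a 0)\<^sup>2) / h - 2 * max a 0) \<le> \<bar>h\<bar>"
      using h by (simp add: pos_divide_le_eq)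
  qed
  show "((\<lambda>h::real. \<bar>h\<bar>) \<longlongrightarrow> 0) (at 0)"
    by (rule tendsto_eq_intros | simp)+
qed

text \<open>Minimality of \<open>v\<close> is tested at the midpoint of \<open>x\<close> and
  \<open>v\<close> pushed against \<open>u\<close>. Uniform convexity with \<open>t = 1/2\<close>
  permits a push of length \<open>\<nu> / 4 * norm (x - v) powr q\<close>; the midpoint halves the
  gap, which turns 1/4 into 1/2.\<close>

lemma uniformly_convex_linear_gap:
  fixes u x v :: "'a::real_inner"
  assumes C: "uniformly_convex_set \<nu> q C" and "\<nu> > 0" and "x \<in> C" "v \<in> C"
    and min: "\<And>y. y \<in> C \<Longrightarrow> u \<bullet> v \<le> u \<bullet> y"
  shows "\<nu> / 2 * norm u * norm (x - v) powr q \<le> u \<bullet> (x - v)"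
proof (cases "u = 0")
  case False
  define w where "w = - (1 / norm u) *\<^sub>R u"
  define y where "y = (1/2) *\<^sub>R x + (1 - 1/2) *\<^sub>R v + ((1/2) * (1 - 1/2) * \<nu> * norm (x - v) powr q) *\<^sub>R w"
  have "norm w = 1" using False by (simp add: w_def)
  moreover have "(1/2 :: real) \<in> {0..1}" by simp
  ultimately have "y \<in> C"
    using C assms(3,4) unfolding uniformly_convex_set_def y_def by blast
  have "u \<bullet> w = - norm u"
    using False by (simp add: w_def dot_square_norm power2_eq_square)
  then have "u \<bullet> y = (u \<bullet> x + u \<bullet> v) / 2 - \<nu> / 4 * norm u * norm (x - v) powr q"
    by (simp add: y_def inner_add_right field_simps)
  with min[OF \<open>y \<in> C\<close>] show ?thesis by (simp add: inner_diff_right field_simps)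
qed simp

lemma convex_lipschitz_gradient_bounds:
  fixes g :: "'a::euclidean_space \<Rightarrow> real"
  assumes "bounded C" and "L-lipschitz_on C (gradient g)" and "convex_on UNIV g"
    and "\<And>x. g differentiable (at x)"
  obtains B where "B > 0" "\<And>x. x \<in> C \<Longrightarrow> norm (gradient g x) \<le> B" "\<And>x. x \<in> C \<Longrightarrow> \<bar>g x\<bar> \<le> B"
    "\<And>x y. x \<in> C \<Longrightarrow> y \<in> C \<Longrightarrow> \<bar>g x - g y\<bar> \<le> B * norm (x - y)"
proof (cases "C = {}")
  case False
  then obtain c where c: "c \<in> C" by blast
  obtain R where R: "\<And>x. x \<in> C \<Longrightarrow> norm x \<le> R" using assms(1) unfolding bounded_iff by blast
  have L: "L \<ge> 0" using assms(2) by (rule lipschitz_on_nonneg)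
  have R0: "R \<ge> 0" using R[OF c] norm_ge_zero[of c] by linarith
  have diam: "norm (x - y) \<le> 2 * R" if "x \<in> C" "y \<in> C" for x y
    using R[OF that(1)] R[OF that(2)] norm_triangle_ineq4[of x y] by simp
  define N where "N = norm (gradient g c) + L * (2 * R)"
  have N: "norm (gradient g x) \<le> N" if "x \<in> C" for x
  proof -
    have "norm (gradient g x - gradient g c) \<le> L * norm (x - c)"
      using lipschitz_onD[OF assms(2) that c] by (simp add: dist_norm)
    also have "\<dots> \<le> L * (2 * R)" using diam[OF that c] L by (rule mult_left_mono)
    finally show ?thesis
      unfolding N_def using norm_triangle_ineq2[of "gradient g x" "gradient g c"] by linarith
  qed
  have N0: "N \<ge> 0" using N[OF c] norm_ge_zero[of "gradient g c"] by linarith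
  \<comment> \<open>The tangent at either endpoint lies below \<open>g\<close> on the whole space,
    so the two points need not be joined by a segment inside \<open>C\<close>.\<close>
  have half: "g x - g y \<le> N * norm (x - y)" if "x \<in> C" "y \<in> C" for x y
  proof -
    have "g x + gradient g x \<bullet> (y - x) \<le> g y"
      by (rule convex_gradient_ineq[OF assms(3,4)])
    then have "g x - g y \<le> gradient g x \<bullet> (x - y)" by (simp add: inner_diff_right)
    also have "\<dots> \<le> norm (gradient g x) * norm (x - y)" by (rule norm_cauchy_schwarz)
    also have "\<dots> \<le> N * norm (x - y)" using N[OF that(1)] by (rule mult_right_mono) simp
    finally show ?thesis .
  qed
  have lip: "\<bar>g x - g y\<bar> \<le> N * norm (x - y)" if "x \<in> C" "y \<in> C" for x y
    using half[OF that] half[OF that(2,1)] by (simp add: norm_minus_commute)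
  have val: "\<bar>g x\<bar> \<le> \<bar>g c\<bar> + N * (2 * R)" if "x \<in> C" for x
    using lip[OF that c] mult_left_mono[OF diam[OF that c] N0] by linarith
  define B where "B = 1 + N + \<bar>g c\<bar> + N * (2 * R)"
  have NB: "N \<le> B" unfolding B_def using N0 R0 by simp
  show ?thesis
  proof
    show "B > 0" unfolding B_def using N0 R0 by (simp add: add_nonneg_nonneg add_pos_nonneg)
    show "norm (gradient g x) \<le> B" if "x \<in> C" for x using N[OF that] NB by linarith
    show "\<bar>g x\<bar> \<le> B" if "x \<in> C" for x using val[OF that] N0 unfolding B_def by linarith
    show "\<bar>g x - g y\<bar> \<le> B * norm (x - y)" if "x \<in> C" "y \<in> C" for x y
      using lip[OF that] mult_right_mono[OF NB, of "norm (x - y)"] by simp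
  qed
qed (use that[of 1] in auto)

subsection \<open>The augmented Lagrangian\<close>

text \<open>The gradient of \<open>F_AL\<close> in \<open>x\<close>. The factor \<rho> is moved
  inside the positive part, so that this reads as a Lagrangian gradient with nonnegative
  multipliers, the form occurring in the condition on \<open>\<A>\<close>.\<close>

definition al_gradient ::
  "(real^'n \<Rightarrow> real) \<Rightarrow> ('m::finite \<Rightarrow> real^'n \<Rightarrow> real) \<Rightarrow> real \<Rightarrow> real^'m \<Rightarrow> real^'n \<Rightarrow> real^'n" where
  "al_gradient f g \<rho> z x =
     gradient f x + (\<Sum>i\<in>UNIV. max (\<rho> * g i x + z $ i) 0 *\<^sub>R gradient (g i) x)"

lemma max_scale_add_divide:
  fixes a s \<rho> :: real
  assumes "\<rho> > 0"
  shows "max (\<rho> * a + s) 0 = \<rho> * max (a + s / \<rho>) 0"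
  using assms by (simp add: max_mult_distrib_left distrib_left)

lemma gradient_F_AL:
  assumes "f differentiable (at x)" and "\<And>i. g i differentiable (at x)" and "\<rho> > 0"
  shows "gradient (\<lambda>y. F_AL f g \<rho> y z) x = al_gradient f g \<rho> z x"
proof (rule gradient_eqI)
  have f: "(f has_derivative (\<lambda>h. h \<bullet> gradient f x)) (at x)"
    using gderiv_gradient[OF assms(1)] by (simp add: gderiv_def)
  have sq: "((\<lambda>y. (max (g i y + z $ i / \<rho>) 0)\<^sup>2) has_derivative
      (\<lambda>h. 2 * max (g i x + z $ i / \<rho>) 0 * (h \<bullet> gradient (g i) x))) (at x)" for i
  proof -
    have "((\<lambda>y. g i y + z $ i / \<rho>) has_derivative (\<lambda>h. h \<bullet> gradient (g i) x)) (at x)"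
      using gderiv_gradient[OF assms(2)[of i]] by (auto simp: gderiv_def intro!: derivative_eq_intros)
    from has_derivative_compose[OF this DERIV_pos_part_sq[unfolded has_field_derivative_def]]
    show ?thesis .
  qed
  show "GDERIV (\<lambda>y. F_AL f g \<rho> y z) x :> al_gradient f g \<rho> z x"
    unfolding gderiv_def F_AL_def \<Psi>_def
    by (rule f sq derivative_eq_intros refl)+
      (auto simp: al_gradient_def fun_eq_iff inner_add_right inner_sum_right sum_distrib_left
        max_scale_add_divide[OF assms(3)] intro!: sum.cong)
qed

text \<open>The tangent inequality for the squared positive part has the nonnegative slope
  \<open>2 * max (g i x + z $ i / \<rho>) 0\<close>, so \<open>g i y - g i x\<close> in it may be
  replaced by its linear lower bound.\<close>

lemma F_AL_above_tangent:
  assumes f: "convex_on UNIV f" "f differentiable (at x)"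
    and g: "\<And>i. convex_on UNIV (g i)" "\<And>i. g i differentiable (at x)"
    and "\<rho> > 0"
  shows "F_AL f g \<rho> x z + al_gradient f g \<rho> z x \<bullet> (y - x) \<le> F_AL f g \<rho> y z"
proof -
  have "max (\<rho> * g i x + z $ i) 0 * (gradient (g i) x \<bullet> (y - x))
      \<le> \<rho> / 2 * ((max (g i y + z $ i / \<rho>) 0)\<^sup>2 - (z $ i / \<rho>)\<^sup>2)
        - \<rho> / 2 * ((max (g i x + z $ i / \<rho>) 0)\<^sup>2 - (z $ i / \<rho>)\<^sup>2)" for i
  proof -
    let ?m = "max (g i x + z $ i / \<rho>) 0"
    have "gradient (g i) x \<bullet> (y - x) \<le> g i y - g i x"
      using convex_gradient_ineq[OF g(1) g(2), of i y] by simp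
    then have "\<rho> * ?m * (gradient (g i) x \<bullet> (y - x)) \<le> \<rho> * ?m * (g i y - g i x)"
      using \<open>\<rho> > 0\<close> by (intro mult_left_mono) auto
    moreover have "\<rho> / 2 * (?m\<^sup>2 + 2 * ?m * (g i y - g i x)) \<le> \<rho> / 2 * (max (g i y + z $ i / \<rho>) 0)\<^sup>2"
      using pos_part_sq_above_tangent[of "g i x + z $ i / \<rho>" "g i y + z $ i / \<rho>"] \<open>\<rho> > 0\<close>
      by (intro mult_left_mono) auto
    ultimately show ?thesis
      unfolding max_scale_add_divide[OF \<open>\<rho> > 0\<close>] by (simp add: algebra_simps)
  qed
  then have "(\<Sum>i\<in>UNIV. max (\<rho> * g i x + z $ i) 0 * (gradient (g i) x \<bullet> (y - x)))
      \<le> \<Psi> g \<rho> y z - \<Psi> g \<rho> x z"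
    unfolding \<Psi>_def sum_distrib_left sum_subtractf[symmetric] by (intro sum_mono) auto
  with convex_gradient_ineq[OF f, of y] show ?thesis
    by (simp add: F_AL_def al_gradient_def inner_add_left inner_sum_left)
qed

text \<open>The minimizer of \<open>\<rho> / 2 * r^2 + r * z $ i\<close> over
  \<open>r \<ge> g i x\<close>; it is also the direction of the multiplier step.\<close>

definition residual ::
  "('m::finite \<Rightarrow> real^'n \<Rightarrow> real) \<Rightarrow> real \<Rightarrow> real^'n \<Rightarrow> real^'m \<Rightarrow> 'm \<Rightarrow> real" where
  "residual g \<rho> x z i = max (g i x) (- (z $ i / \<rho>))"

lemma \<Psi>_eq_residual:
  assumes "\<rho> > 0"
  shows "\<Psi> g \<rho> x z = (\<Sum>i\<in>UNIV. \<rho> / 2 * (residual g \<rho> x z i)\<^sup>2 + residual g \<rho> x z i * z $ i)"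
proof -
  have max: "max (g i x + z $ i / \<rho>) 0 = residual g \<rho> x z i + z $ i / \<rho>" for i
    by (simp add: residual_def max_def)
  have "\<rho> / 2 * ((r + s / \<rho>)\<^sup>2 - (s / \<rho>)\<^sup>2) = \<rho> / 2 * r\<^sup>2 + r * s" for r s
    using assms by (simp add: power2_eq_square field_simps)
  then show ?thesis
    unfolding \<Psi>_def sum_distrib_left max by presburger
qed

text \<open>Since \<open>r i \<ge> g i x\<close>, the number \<open>r i + z $ i / \<rho>\<close>
  dominates the positive part in absolute value. The freedom in \<open>r\<close> allows residuals of
  other parameters to be inserted.\<close>

lemma \<Psi>_le:
  assumes "\<rho> > 0" and "\<And>i. g i x \<le> r i"
  shows "\<Psi> g \<rho> x z \<le> (\<Sum>i\<in>UNIV. \<rho> / 2 * (r i)\<^sup>2 + r i * z $ i)"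
  unfolding \<Psi>_def sum_distrib_left
proof (rule sum_mono)
  fix i
  have "(max (g i x + z $ i / \<rho>) 0)\<^sup>2 \<le> (r i + z $ i / \<rho>)\<^sup>2"
    using assms(2)[of i] by (intro abs_le_square_iff[THEN iffD1]) (simp add: max_def abs_if)
  then have "\<rho> / 2 * ((max (g i x + z $ i / \<rho>) 0)\<^sup>2 - (z $ i / \<rho>)\<^sup>2)
      \<le> \<rho> / 2 * ((r i + z $ i / \<rho>)\<^sup>2 - (z $ i / \<rho>)\<^sup>2)"
    using assms(1) by (intro mult_left_mono) auto
  also have "\<dots> = \<rho> / 2 * (r i)\<^sup>2 + r i * z $ i"
    using assms(1) by (simp add: power2_eq_square field_simps)
  finally show "\<rho> / 2 * ((max (g i x + z $ i / \<rho>) 0)\<^sup>2 - (z $ i / \<rho>)\<^sup>2)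
      \<le> \<rho> / 2 * (r i)\<^sup>2 + r i * z $ i" .
qed

text \<open>The old residual is a competitor in \<open>\<Psi>_le\<close> for the new parameters.
  Compared with \<open>\<Psi>_eq_residual\<close>, the quadratic coefficient grows by
  \<open>(\<rho>' - \<rho>) / 2\<close> and the linear term by \<open>s\<close> times the squared
  residual.\<close>

lemma \<Psi>_update:
  assumes "\<rho> > 0" "\<rho>' > 0" and z': "\<And>i. z' $ i = z $ i + s * residual g \<rho> x z i"
  shows "\<Psi> g \<rho>' x z' \<le> \<Psi> g \<rho> x z + ((\<rho>' - \<rho>) / 2 + s) * (\<Sum>i\<in>UNIV. (residual g \<rho> x z i)\<^sup>2)"
proof -
  have "\<Psi> g \<rho>' x z' \<le> (\<Sum>i\<in>UNIV. \<rho>' / 2 * (residual g \<rho> x z i)\<^sup>2 + residual g \<rho> x z i * z' $ i)"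
    using assms(2) by (rule \<Psi>_le) (simp add: residual_def)
  also have "\<dots> = \<Psi> g \<rho> x z + ((\<rho>' - \<rho>) / 2 + s) * (\<Sum>i\<in>UNIV. (residual g \<rho> x z i)\<^sup>2)"
    unfolding \<Psi>_eq_residual[OF assms(1)] z' sum_distrib_left sum.distrib[symmetric]
    by (intro sum.cong) (auto simp: power2_eq_square field_simps)
  finally show ?thesis .
qed

lemma \<Psi>_nonpos:
  assumes "\<rho> > 0" and "\<And>i. g i x \<le> 0"
  shows "\<Psi> g \<rho> x z \<le> 0"
  using \<Psi>_le[of \<rho> g x "\<lambda>_. 0" z] assms by simp

text \<open>The saddle-point hypothesis is what a KKT point \<open>y\<close> provides, with \<open>L\<close> the optimal value.\<close>

lemma residual_sq_le:
  assumes "\<rho> > 0" and y: "\<And>i. y $ i \<ge> 0" and saddle: "L - (\<Sum>i\<in>UNIV. y $ i * g i x) \<le> f x"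
  shows "(\<Sum>i\<in>UNIV. (residual g \<rho> x z i)\<^sup>2)
    \<le> 4 / \<rho> * (F_AL f g \<rho> x z - L + (\<Sum>i\<in>UNIV. (z $ i - y $ i)\<^sup>2) / \<rho>)"
proof -
  have "\<rho> / 4 * (residual g \<rho> x z i)\<^sup>2 - (z $ i - y $ i)\<^sup>2 / \<rho>
      \<le> \<rho> / 2 * (residual g \<rho> x z i)\<^sup>2 + residual g \<rho> x z i * z $ i - y $ i * g i x" (is "?l i \<le> ?r i") for i
  proof -
    let ?r = "residual g \<rho> x z i"
    have "y $ i * g i x \<le> y $ i * ?r"
      using y by (intro mult_left_mono) (auto simp: residual_def)
    \<comment> \<open>Half of the quadratic term \<open>\<rho> / 2 * ?r^2\<close> is spent on
      absorbing the cross term \<open>?r * (z $ i - y $ i)\<close>.\<close>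
    moreover have "0 \<le> (\<rho> * ?r / 2 + (z $ i - y $ i))\<^sup>2 / \<rho>"
      using assms(1) by simp
    moreover have "(\<rho> * ?r / 2 + (z $ i - y $ i))\<^sup>2 / \<rho>
        = \<rho> / 4 * ?r\<^sup>2 + ?r * (z $ i - y $ i) + (z $ i - y $ i)\<^sup>2 / \<rho>"
      using assms(1) by (simp add: power2_eq_square field_simps)
    ultimately show ?thesis by (simp add: algebra_simps)
  qed
  then have "(\<Sum>i\<in>UNIV. ?l i) \<le> (\<Sum>i\<in>UNIV. ?r i)" by (intro sum_mono) auto
  also have "\<dots> = \<Psi> g \<rho> x z - (\<Sum>i\<in>UNIV. y $ i * g i x)"
    by (simp add: \<Psi>_eq_residual[OF assms(1)] sum_subtractf)
  also have "\<dots> \<le> F_AL f g \<rho> x z - L"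
    using saddle by (simp add: F_AL_def)
  finally have "\<rho> / 4 * (\<Sum>i\<in>UNIV. (residual g \<rho> x z i)\<^sup>2)
      \<le> F_AL f g \<rho> x z - L + (\<Sum>i\<in>UNIV. (z $ i - y $ i)\<^sup>2) / \<rho>"
    by (simp add: sum_subtractf sum_distrib_left sum_divide_distrib)
  then show ?thesis using assms(1) by (simp add: field_simps)
qed

subsection \<open>Rates of recursive sequences\<close>

text \<open>Induction on \<open>t k \<le> B * real k powr (- s)\<close>. The contraction gains
  \<open>c * B * real k powr (- p - s)\<close>: one half pays for the forcing term, the other for
  the decrease of the bound itself, which is at most \<open>B * s * real k powr (- s - 1)\<close>
  and hence of smaller order as \<open>p < 1\<close>.\<close>

lemma recursion_rate:
  fixes t :: "nat \<Rightarrow> real"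
  assumes rec: "\<forall>\<^sub>F k in sequentially. t (Suc k) \<le> (1 - a k) * t k + M * real k powr (- p - s)"
    and a: "\<forall>\<^sub>F k in sequentially. c * real k powr (- p) \<le> a k \<and> a k \<le> 1"
    and "c > 0" "p < 1" "s \<ge> 0" "\<And>k. t k \<ge> 0"
  shows "t \<in> O(\<lambda>k. real k powr (- s))"
proof -
  have "((\<lambda>k. real k powr (p - 1)) \<longlongrightarrow> 0) sequentially"
    by (rule tendsto_neg_powr) (use assms(4) filterlim_real_sequentially in auto)
  then have "((\<lambda>k. s * real k powr (p - 1)) \<longlongrightarrow> 0) sequentially"
    by (rule tendsto_mult_right_zero)
  then have small: "\<forall>\<^sub>F k in sequentially. s * real k powr (p - 1) < c / 2"
    by (rule order_tendstoD) (use assms(3) in simp)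
  from eventually_conj[OF eventually_conj[OF rec a] eventually_conj[OF small eventually_gt_at_top[of 0]]]
  obtain K where K: "\<And>k. k \<ge> K \<Longrightarrow> t (Suc k) \<le> (1 - a k) * t k + M * real k powr (- p - s)
      \<and> c * real k powr (- p) \<le> a k \<and> a k \<le> 1 \<and> s * real k powr (p - 1) < c / 2 \<and> k > 0"
    unfolding eventually_sequentially by (metis (no_types, lifting))
  \<comment> \<open>The first entry starts the induction at \<open>K\<close>; the last one gives
    \<open>M \<le> c / 2 * B\<close>.\<close>
  define B where "B = max (t K * real K powr s) (max 0 (2 * M / c))"
  have B: "B \<ge> 0" "2 * M / c \<le> B" "t K * real K powr s \<le> B" by (auto simp: B_def)
  have M: "M \<le> c / 2 * B" using B(2) assms(3) by (simp add: field_simps)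
  have bound: "t k \<le> B * real k powr (- s)" if "k \<ge> K" for k
    using that
  proof (induction k rule: dec_induct)
    case base
    show ?case using B(3) K[of K] by (simp add: powr_minus field_simps)
  next
    case (step k)
    note k = K[OF step(1)]
    have kp: "real k > 0" using k by simp
    \<comment> \<open>Factoring out \<open>real k powr (- s)\<close> leaves
      \<open>(1 + 1 / k) powr (- s) \<ge> exp (- s / k) \<ge> 1 - s / k\<close>.\<close>
    have drop: "real k powr (- s) - s * real k powr (- s - 1) \<le> real (Suc k) powr (- s)"
    proof -
      have "- s * ln (1 + 1 / real k) \<ge> - (s * (1 / real k))"
        using kp assms(5) mult_left_mono[OF ln_add_one_self_le_self[of "1 / real k"] assms(5)] by simp
      then have "exp (- (s / real k)) \<le> (1 + 1 / real k) powr (- s)"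
        unfolding powr_def using kp by (simp add: add_pos_pos less_imp_neq[symmetric])
      moreover have "1 - s / real k \<le> exp (- (s / real k))"
        using exp_ge_add_one_self[of "- (s / real k)"] by simp
      ultimately have "real k powr (- s) * (1 - s / real k) \<le> real k powr (- s) * (1 + 1 / real k) powr (- s)"
        by (intro mult_left_mono) auto
      also have "\<dots> = real (Suc k) powr (- s)"
      proof -
        have "real k * (1 + 1 / real k) = real (Suc k)" using kp by (simp add: field_simps)
        then show ?thesis by (metis powr_mult)
      qed
      finally show ?thesis
        using kp by (simp add: powr_diff algebra_simps)
    qed
    have "t (Suc k) \<le> (1 - a k) * t k + M * real k powr (- p - s)" using k by blast
    also have "(1 - a k) * t k \<le> (1 - a k) * (B * real k powr (- s))"
      using k step.IH by (intro mult_left_mono) auto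
    also have "\<dots> \<le> (1 - c * real k powr (- p)) * (B * real k powr (- s))"
      using k B(1) by (intro mult_right_mono) auto
    also have "\<dots> = B * real k powr (- s) - c * B * real k powr (- p - s)"
      by (simp add: algebra_simps powr_add[symmetric])
    also have "M * real k powr (- p - s) \<le> c / 2 * B * real k powr (- p - s)"
      using M by (rule mult_right_mono) simp
    finally have 1: "t (Suc k) \<le> B * (real k powr (- s) - c / 2 * real k powr (- p - s))"
      by (simp add: algebra_simps)
    have "real k powr (p - 1 + (- p - s)) = real k powr (- s - 1)"
      by (rule arg_cong) simp
    then have "s * real k powr (- s - 1) = s * real k powr (p - 1) * real k powr (- p - s)"
      by (simp only: powr_add mult.assoc)
    also have "\<dots> \<le> c / 2 * real k powr (- p - s)"
      using k by (intro mult_right_mono) auto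
    finally have "real k powr (- s) - c / 2 * real k powr (- p - s) \<le> real (Suc k) powr (- s)"
      using drop by linarith
    from mult_left_mono[OF this B(1)] 1 show ?case by linarith
  qed
  show ?thesis
    using bound assms(6) by (intro bigoI[where c = B] eventually_sequentiallyI[where c = K]) auto
qed

lemma bigtheta_powr_bounds:
  fixes f :: "nat \<Rightarrow> real"
  assumes "f \<in> \<Theta>(\<lambda>k. real k powr r)" and "\<And>k. f k \<ge> 0"
  obtains c c' where "c > 0" "c' > 0"
    "\<forall>\<^sub>F k in sequentially. c * real k powr r \<le> f k \<and> f k \<le> c' * real k powr r"
proof -
  obtain c' where "c' > 0" "\<forall>\<^sub>F k in sequentially. norm (f k) \<le> c' * norm (real k powr r)"
    using landau_o.bigE[OF bigthetaD1[OF assms(1)]] by metis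
  moreover obtain c where "c > 0" "\<forall>\<^sub>F k in sequentially. norm (f k) \<ge> c * norm (real k powr r)"
    using landau_omega.bigE[OF bigthetaD2[OF assms(1)]] by metis
  ultimately show ?thesis
    using assms(2) by (intro that[of c c']) (auto elim: eventually_elim2)
qed

text \<open>At \<open>k = 0\<close> both sides are 0 by the convention for \<open>powr\<close>; all
  other \<open>k\<close> are at least 1.\<close>

lemma real_powr_mono:
  assumes "a \<le> b"
  shows "real k powr a \<le> real k powr b"
  using assms by (cases "k = 0") (auto intro: powr_mono)

lemma powr_neg_tendsto_0: "s > 0 \<Longrightarrow> (\<lambda>k. c * real k powr (- s)) \<longlonglongrightarrow> 0"
  by (intro tendsto_mult_right_zero tendsto_neg_powr) (auto simp: filterlim_real_sequentially)

text \<open>Half of the gap absorbs the curvature error \<open>E\<close>, the other half is at least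
  \<open>t k / 2\<close> and contracts by \<open>1 - \<alpha> k / 2\<close>. The growth factor
  \<open>1 + e k\<close> spoils this only to \<open>1 - \<alpha> k / 4\<close>, because
  \<open>e k\<close> is of order 1/k and thus eventually below
  \<open>\<alpha> k / 4\<close>.\<close>

lemma rate_from_gap:
  fixes t gp \<alpha> e b E :: "nat \<Rightarrow> real"
  assumes t: "\<And>k. 0 \<le> t k" "\<And>k. t k \<le> gp k"
    and rec: "\<And>k. t (Suc k) \<le> (1 + e k) * max (t k - \<alpha> k * gp k + \<alpha> k * E k) 0 + b k"
    and e: "\<And>k. 0 \<le> e k" "\<forall>\<^sub>F k in sequentially. e k \<le> N * real k powr (- 1)"
    and b: "\<forall>\<^sub>F k in sequentially. b k \<le> N * real k powr (- p - s)"
    and \<alpha>: "c > 0" "\<forall>\<^sub>F k in sequentially. c * real k powr (- p) \<le> \<alpha> k \<and> \<alpha> k \<le> c' * real k powr (- p)"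
      "\<And>k. \<alpha> k \<in> {0..1}"
    and E: "R \<ge> 0" "\<forall>\<^sub>F k in sequentially. E k \<le> gp k / 2 + R * real k powr (- s)"
    and p: "p < 1" and s: "0 \<le> s"
  shows "t \<in> O(\<lambda>k. real k powr (- s))"
proof -
  have tend: "(\<lambda>k. N * real k powr (- (1 - p))) \<longlonglongrightarrow> 0"
    "(\<lambda>k. N * real k powr (- 1)) \<longlonglongrightarrow> 0"
    using p by (intro powr_neg_tendsto_0; simp)+
  have "\<forall>\<^sub>F k in sequentially. N * real k powr (- (1 - p)) < c / 4"
    "\<forall>\<^sub>F k in sequentially. N * real k powr (- 1) < 1"
    using tend \<alpha>(1) by (auto intro!: order_tendstoD(2))
  with e(2) b \<alpha>(2) E(2)
  have "\<forall>\<^sub>F k in sequentially. t (Suc k) \<le> (1 - \<alpha> k / 4) * t k + (2 * R * c' + N) * real k powr (- p - s)"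
  proof eventually_elim
    case (elim k)
    have \<alpha>k: "0 \<le> \<alpha> k" "\<alpha> k \<le> 1" using \<alpha>(3)[of k] by auto
    have "N * real k powr (- 1) = N * real k powr (- (1 - p)) * real k powr (- p)"
      by (simp add: mult.assoc powr_add[symmetric])
    also have "\<dots> \<le> c / 4 * real k powr (- p)"
      using elim by (intro mult_right_mono) auto
    finally have e4: "e k \<le> \<alpha> k / 4" "e k \<le> 1" using elim by linarith+
    let ?R = "\<alpha> k * (R * real k powr (- s))"
    have R0: "0 \<le> ?R" using \<alpha>k E(1) by simp
    have "\<alpha> k * E k \<le> \<alpha> k * (gp k / 2 + R * real k powr (- s))"
      using elim \<alpha>k by (intro mult_left_mono) auto
    moreover have "\<alpha> k * t k \<le> \<alpha> k * gp k" using t(2) \<alpha>k by (intro mult_left_mono) auto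
    ultimately have "t k - \<alpha> k * gp k + \<alpha> k * E k \<le> (1 - \<alpha> k / 2) * t k + ?R"
      by (simp add: algebra_simps)
    moreover have "0 \<le> (1 - \<alpha> k / 2) * t k + ?R" using \<alpha>k t(1)[of k] R0 by simp
    ultimately have "max (t k - \<alpha> k * gp k + \<alpha> k * E k) 0 \<le> (1 - \<alpha> k / 2) * t k + ?R" by simp
    then have "(1 + e k) * max (t k - \<alpha> k * gp k + \<alpha> k * E k) 0 \<le> (1 + e k) * ((1 - \<alpha> k / 2) * t k + ?R)"
      using e(1)[of k] by (intro mult_left_mono) auto
    also have "\<dots> = (1 + e k) * (1 - \<alpha> k / 2) * t k + (1 + e k) * ?R" by (simp add: algebra_simps)
    also have "(1 + e k) * (1 - \<alpha> k / 2) * t k \<le> (1 - \<alpha> k / 4) * t k"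
    proof (rule mult_right_mono)
      have "0 \<le> e k * \<alpha> k" using e(1) \<alpha>k by simp
      then show "(1 + e k) * (1 - \<alpha> k / 2) \<le> 1 - \<alpha> k / 4" using e4 by (simp add: algebra_simps)
    qed (rule t)
    also have "(1 + e k) * ?R \<le> 2 * ?R"
      using e4 R0 by (intro mult_right_mono) auto
    also have "?R \<le> (c' * real k powr (- p)) * (R * real k powr (- s))"
      using elim E(1) by (intro mult_right_mono) auto
    also have "\<dots> = R * c' * real k powr (- p - s)" by (simp add: powr_diff powr_minus field_simps)
    finally show ?case using rec[of k] elim by (simp add: algebra_simps)
  qed
  then show ?thesis
  proof (rule recursion_rate[where a = "\<lambda>k. \<alpha> k / 4" and c = "c / 4" and p = p])
    show "\<forall>\<^sub>F k in sequentially. c / 4 * real k powr (- p) \<le> \<alpha> k / 4 \<and> \<alpha> k / 4 \<le> 1"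
      using \<alpha>(2)
    proof eventually_elim
      case (elim k)
      then show ?case using \<alpha>(3)[of k] by auto
    qed
  qed (use assms in auto)
qed

text \<open>A form of Young's inequality by a threshold on \<open>n\<close>: either
  \<open>n powr (q - 2)\<close> is large enough for the first term to dominate, or \<open>n\<close>
  is bounded in terms of \<open>\<theta> / \<kappa>\<close>.\<close>

lemma square_le_powr_add:
  fixes n \<theta> \<kappa> q :: real
  assumes "n \<ge> 0" "\<theta> \<ge> 0" "\<kappa> > 0" "q > 2"
  shows "\<theta> * n\<^sup>2 \<le> \<kappa> / 2 * n powr q + \<theta> * (2 * \<theta> / \<kappa>) powr (2 / (q - 2))"
proof (cases "n = 0")
  case False
  then have n: "n > 0" using assms by simp
  have "q - 2 \<noteq> 0" using assms(4) by simp
  then have "(q - 2) * (2 / (q - 2)) = 2"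
    by (metis nonzero_mult_div_cancel_left times_divide_eq_right)
  then have sq: "n powr q = n powr (q - 2) * n\<^sup>2" "n\<^sup>2 = (n powr (q - 2)) powr (2 / (q - 2))"
    using n assms(4) by (simp_all only: powr_powr) (simp_all add: powr_add[symmetric] flip: powr_numeral)
  show ?thesis
  proof (cases "\<theta> \<le> \<kappa> / 2 * n powr (q - 2)")
    case True
    then have "\<theta> * n\<^sup>2 \<le> \<kappa> / 2 * n powr (q - 2) * n\<^sup>2" by (rule mult_right_mono) simp
    moreover have "0 \<le> \<theta> * (2 * \<theta> / \<kappa>) powr (2 / (q - 2))" using assms by simp
    ultimately show ?thesis by (simp add: sq(1))
  next
    case False
    then have "n powr (q - 2) \<le> 2 * \<theta> / \<kappa>" using assms(3) by (simp add: field_simps)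
    then have "n\<^sup>2 \<le> (2 * \<theta> / \<kappa>) powr (2 / (q - 2))"
      unfolding sq(2) using assms(4) by (intro powr_mono2) auto
    then have "\<theta> * n\<^sup>2 \<le> \<theta> * (2 * \<theta> / \<kappa>) powr (2 / (q - 2))"
      using assms(2) by (rule mult_left_mono)
    moreover have "0 \<le> \<kappa> / 2 * n powr q" using assms(3) by simp
    ultimately show ?thesis by linarith
  qed
qed (use assms in simp)

text \<open>The last term of \<open>square_le_powr_add\<close> scales as the power
  \<open>1 + 2 / (q - 2) = q / (q - 2) = 1 / \<mu>\<close> of \<theta>, which turns the decay
  exponent \<open>r\<close> into \<open>r / \<mu>\<close>.\<close>

lemma square_le_powr_rate:
  fixes n \<theta> \<theta>\<^sub>0 \<kappa> q r y :: real
  assumes "n \<ge> 0" "\<theta> \<ge> 0" "\<theta> \<le> \<theta>\<^sub>0 * y powr (- r)" "\<kappa> > 0" "q > 2" "\<theta>\<^sub>0 \<ge> 0" "\<mu> = 1 - 2 / q"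
  shows "\<theta> * n\<^sup>2 \<le> \<kappa> / 2 * n powr q + \<theta>\<^sub>0 * (2 * \<theta>\<^sub>0 / \<kappa>) powr (2 / (q - 2)) * y powr (- (r / \<mu>))"
proof -
  let ?a = "2 / (q - 2)"
  have "\<mu> = (q - 2) / q" "1 + ?a = q / (q - 2)" using assms(5,7) by (simp_all add: field_simps)
  then have "1 + ?a = 1 / \<mu>" by simp
  then have "r * (1 + ?a) = r / \<mu>" by simp
  then have exponent: "- r + - r * ?a = - (r / \<mu>)" by (simp add: algebra_simps)
  have "(2 * \<theta> / \<kappa>) powr ?a \<le> (2 * \<theta>\<^sub>0 / \<kappa> * y powr (- r)) powr ?a"
    using assms by (intro powr_mono2) (auto simp: field_simps)
  also have "\<dots> = (2 * \<theta>\<^sub>0 / \<kappa>) powr ?a * y powr (- r * ?a)"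
    by (simp only: powr_mult powr_powr)
  finally have "\<theta> * (2 * \<theta> / \<kappa>) powr ?a \<le> \<theta>\<^sub>0 * y powr (- r) * ((2 * \<theta>\<^sub>0 / \<kappa>) powr ?a * y powr (- r * ?a))"
    using assms by (intro mult_mono) auto
  also have "\<dots> = \<theta>\<^sub>0 * (2 * \<theta>\<^sub>0 / \<kappa>) powr ?a * y powr (- r + - r * ?a)"
    by (simp only: powr_add mult_ac)
  finally show ?thesis
    using square_le_powr_add[OF assms(1,2,4,5)] unfolding exponent by linarith
qed

subsection \<open>One step of the algorithm\<close>

locale indicator_fw_alm =
  convex_program f "Ind C" g Lf D Lg + fw_alm f "Ind C" g lam \<sigma> \<alpha> x v z
  for f :: "real^'n \<Rightarrow> real" and C :: "(real^'n) set" and g :: "'m::finite \<Rightarrow> real^'n \<Rightarrow> real"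
    and Lf D :: real and Lg :: "'m \<Rightarrow> real" and lam \<sigma> \<alpha> :: "nat \<Rightarrow> real"
    and x v :: "nat \<Rightarrow> real^'n" and z :: "nat \<Rightarrow> real^'m" +
  assumes C_compact: "compact C" and C_convex: "convex C"
begin

section \<open>Feasibility of the iterates and the Frank-Wolfe gap\<close>

lemma edom_Ind: "edom (Ind C) = C"
  by (auto simp: edom_def Ind_def split: if_splits)

definition direction :: "nat \<Rightarrow> real^'n" where
  "direction k = al_gradient f g (lam k) (z k) (x k)"

definition gap :: "nat \<Rightarrow> real" where
  "gap k = direction k \<bullet> (x k - v k)"

definition val :: "nat \<Rightarrow> real" where
  "val k = F_AL f g (lam k) (x k) (z k)"

text \<open>The coefficient \<open>(lam (Suc k) - lam k) / 2 + \<sigma> k\<close> from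
  \<open>\<Psi>_update\<close> times the factor \<open>4 / lam k\<close> from
  \<open>residual_sq_le\<close>.\<close>

definition drift :: "nat \<Rightarrow> real" where
  "drift k = (2 * (lam (Suc k) - lam k) + 4 * \<sigma> k) / lam k"

lemma drift_nonneg: "drift k \<ge> 0"
  unfolding drift_def using strict_monoD[OF lam_strict_mono, of k "Suc k"] \<sigma>_pos[of k] lam_pos[of k]
  by (intro divide_nonneg_pos) auto

lemma v_minimizer: "minimizer (\<lambda>w. ereal (direction k \<bullet> w) + Ind C w) (v k)"
  using v_step[of k] unfolding direction_def
  by (simp add: gradient_F_AL[OF f_diff g_diff lam_pos])

lemma v_in_C: "v k \<in> C"
proof (rule ccontr)
  assume "v k \<notin> C"
  moreover have "x 0 \<in> C" using x0 by (simp add: edom_Ind)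
  ultimately have "ereal (direction k \<bullet> x 0) + Ind C (x 0) < ereal (direction k \<bullet> v k) + Ind C (v k)"
    by (simp add: Ind_def)
  then show False using v_minimizer[of k] unfolding is_arg_min_def by blast
qed

lemma v_linear_min: "y \<in> C \<Longrightarrow> direction k \<bullet> v k \<le> direction k \<bullet> y"
  using v_minimizer[of k] v_in_C[of k] unfolding is_arg_min_def
  by (metis Ind_def add.right_neutral ereal_less_eq(3) linorder_not_less)

lemma x_in_C: "x k \<in> C"
proof (induction k)
  case 0
  show ?case using x0 by (simp add: edom_Ind)
next
  case (Suc k)
  have "x (Suc k) = (1 - \<alpha> k) *\<^sub>R x k + \<alpha> k *\<^sub>R v k"
    by (simp add: x_step algebra_simps)
  also have "\<dots> \<in> C"
    using C_convex Suc v_in_C[of k] \<alpha>_range[of k] by (intro convexD) auto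
  finally show ?case .
qed

lemma gap_ge:
  assumes "y \<in> C" shows "direction k \<bullet> (x k - y) \<le> gap k"
  using v_linear_min[OF assms] by (simp add: gap_def inner_diff_right)

lemma z_step_residual: "z (Suc k) $ i = z k $ i + \<sigma> k * residual g (lam k) (x (Suc k)) (z k) i"
  by (simp add: z_step residual_def max.commute)

text \<open>The residual is at least \<open>- z / lam\<close>, so a step removes at most the
  fraction \<open>\<sigma> k / lam k \<le> 1\<close> of the multiplier.\<close>

lemma z_nonneg: "z k $ i \<ge> 0"
proof (induction k)
  case (Suc k)
  have "\<sigma> k / lam k * z k $ i \<le> 1 * z k $ i"
    using \<sigma>_le_lam[of k] lam_pos[of k] Suc by (intro mult_right_mono) auto
  moreover have "\<sigma> k * (- (z k $ i / lam k)) \<le> \<sigma> k * residual g (lam k) (x (Suc k)) (z k) i"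
    using \<sigma>_pos[of k] by (intro mult_left_mono) (auto simp: residual_def)
  ultimately show ?case by (simp add: z_step_residual)
qed (rule z0)

section \<open>Uniform bounds on constraints, multipliers and curvature\<close>

lemma g_bounds:
  obtains B where "B > 0" "\<And>i y. y \<in> C \<Longrightarrow> norm (gradient (g i) y) \<le> B"
    "\<And>i y. y \<in> C \<Longrightarrow> \<bar>g i y\<bar> \<le> B"
    "\<And>i a b. a \<in> C \<Longrightarrow> b \<in> C \<Longrightarrow> \<bar>g i a - g i b\<bar> \<le> B * norm (a - b)"
proof -
  have "\<exists>B > 0. (\<forall>y\<in>C. norm (gradient (g i) y) \<le> B) \<and> (\<forall>y\<in>C. \<bar>g i y\<bar> \<le> B)
      \<and> (\<forall>a\<in>C. \<forall>b\<in>C. \<bar>g i a - g i b\<bar> \<le> B * norm (a - b))" for i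
    by (rule convex_lipschitz_gradient_bounds[OF compact_imp_bounded[OF C_compact]
        g_smooth[unfolded edom_Ind, of i] g_convex g_diff]) blast
  then have "\<exists>b. \<forall>i. b i > 0 \<and> (\<forall>y\<in>C. norm (gradient (g i) y) \<le> b i) \<and> (\<forall>y\<in>C. \<bar>g i y\<bar> \<le> b i)
      \<and> (\<forall>y\<in>C. \<forall>y'\<in>C. \<bar>g i y - g i y'\<bar> \<le> b i * norm (y - y'))"
    by (intro choice allI)
  then obtain b where b: "\<And>i. b i > 0" "\<And>i y. y \<in> C \<Longrightarrow> norm (gradient (g i) y) \<le> b i"
    "\<And>i y. y \<in> C \<Longrightarrow> \<bar>g i y\<bar> \<le> b i"
    "\<And>i y y'. y \<in> C \<Longrightarrow> y' \<in> C \<Longrightarrow> \<bar>g i y - g i y'\<bar> \<le> b i * norm (y - y')"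
    by blast
  define B where "B = 1 + (\<Sum>i\<in>UNIV. b i)"
  have bB: "b i \<le> B" for i
  proof -
    have "b i \<le> sum b UNIV" using b(1) by (intro member_le_sum) (auto intro: less_imp_le)
    then show ?thesis by (simp add: B_def)
  qed
  show ?thesis
  proof
    show "B > 0" unfolding B_def using b(1) by (intro add_pos_nonneg sum_nonneg) (auto intro: less_imp_le)
    show "norm (gradient (g i) y) \<le> B" "\<bar>g i y\<bar> \<le> B" if "y \<in> C" for i y
      using b(2,3)[OF that, of i] bB[of i] by linarith+
    show "\<bar>g i y - g i y'\<bar> \<le> B * norm (y - y')" if "y \<in> C" "y' \<in> C" for i y y'
      using b(4)[OF that, of i] mult_right_mono[OF bB[of i] norm_ge_zero[of "y - y'"]] by linarith
  qed
qed

text \<open>The entry \<open>- z / lam\<close> is nonpositive and \<open>g\<close> is bounded on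
  \<open>C\<close>, so the residual is bounded above; the increments then sum to at most a multiple
  of the total of \<sigma>.\<close>

lemma z_bounded: obtains Z where "Z > 0" "\<And>k i. z k $ i \<le> Z"
proof -
  obtain B where B: "B > 0" "\<And>i y. y \<in> C \<Longrightarrow> norm (gradient (g i) y) \<le> B"
    "\<And>i y. y \<in> C \<Longrightarrow> \<bar>g i y\<bar> \<le> B"
    "\<And>i a b. a \<in> C \<Longrightarrow> b \<in> C \<Longrightarrow> \<bar>g i a - g i b\<bar> \<le> B * norm (a - b)"
    by (rule g_bounds[OF that])
  have "z k $ i \<le> z 0 $ i + B * sum \<sigma> {..<k}" for k i
  proof (induction k)
    case (Suc k)
    have "residual g (lam k) (x (Suc k)) (z k) i \<le> B"
    proof -
      have "z k $ i / lam k \<ge> 0" using z_nonneg lam_pos[of k] by (intro divide_nonneg_pos) auto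
      then show ?thesis
        using B(1) B(3)[OF x_in_C[of "Suc k"], of i] by (auto simp: residual_def)
    qed
    then have "\<sigma> k * residual g (lam k) (x (Suc k)) (z k) i \<le> \<sigma> k * B"
      using \<sigma>_pos[of k] by (intro mult_left_mono) auto
    with Suc show ?case by (simp add: z_step_residual algebra_simps)
  qed simp
  moreover have "sum \<sigma> {..<k} \<le> suminf \<sigma>" for k
    using \<sigma>_summable \<sigma>_pos by (intro sum_le_suminf) (auto intro: less_imp_le)
  then have "B * sum \<sigma> {..<k} \<le> B * suminf \<sigma>" for k
    using B(1) by (intro mult_left_mono) auto
  ultimately have "z k $ i \<le> z 0 $ i + B * suminf \<sigma>" for k i
    by (meson add_left_mono order.trans)
  moreover have "z 0 $ i \<le> (\<Sum>i\<in>UNIV. z 0 $ i)" for i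
    by (rule member_le_sum) (auto simp: z0)
  ultimately have le: "z k $ i \<le> (\<Sum>i\<in>UNIV. z 0 $ i) + B * suminf \<sigma>" for k i
    by (meson add_right_mono order.trans)
  show ?thesis
    by (rule that[of "max 1 ((\<Sum>i\<in>UNIV. z 0 $ i) + B * suminf \<sigma>)"]) (use le in \<open>auto simp: le_max_iff_disj\<close>)
qed

text \<open>The multipliers \<open>max (lam k * g + z k) 0\<close> have both Lipschitz constant and
  size of order \<open>lam k\<close>. Contributions without a factor \<open>lam k\<close> are
  absorbed through \<open>1 \<le> lam k / lam 0\<close>.\<close>

lemma direction_lipschitz:
  obtains M where "M > 0"
    "\<And>k a b. a \<in> C \<Longrightarrow> b \<in> C \<Longrightarrow>
      norm (al_gradient f g (lam k) (z k) a - al_gradient f g (lam k) (z k) b) \<le> M * lam k * norm (a - b)"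
proof -
  obtain B where B: "B > 0" "\<And>i y. y \<in> C \<Longrightarrow> norm (gradient (g i) y) \<le> B"
    "\<And>i y. y \<in> C \<Longrightarrow> \<bar>g i y\<bar> \<le> B"
    "\<And>i a b. a \<in> C \<Longrightarrow> b \<in> C \<Longrightarrow> \<bar>g i a - g i b\<bar> \<le> B * norm (a - b)"
    by (rule g_bounds[OF that])
  obtain Z where Z: "Z > 0" "\<And>k i. z k $ i \<le> Z" by (rule z_bounded[OF that])
  define N where "N i = B * B + (B + Z / lam 0) * Lg i" for i
  define M where "M = Lf / lam 0 + (\<Sum>i\<in>UNIV. N i)"
  have N: "N i > 0" for i
    unfolding N_def using B(1) Z(1) Lg_pos lam_pos[of 0]
    by (intro add_pos_pos mult_pos_pos divide_pos_pos)
  show ?thesis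
  proof
    show "M > 0"
      unfolding M_def using N Lf_pos lam_pos[of 0]
      by (intro add_pos_nonneg divide_pos_pos sum_nonneg) (auto intro: less_imp_le)
    fix k a b assume ab: "a \<in> C" "b \<in> C"
    have l0: "lam 0 \<le> lam k" "0 < lam 0" "0 < lam k"
      using lam_strict_mono lam_pos by (auto simp: strict_mono_less_eq)
    let ?m = "\<lambda>i y. max (lam k * g i y + z k $ i) 0"
    let ?n = "norm (a - b)"
    have fab: "norm (gradient f a - gradient f b) \<le> Lf / lam 0 * lam k * ?n"
    proof -
      have "norm (gradient f a - gradient f b) \<le> Lf * ?n"
        using lipschitz_onD[OF f_smooth, of a b] by (simp add: dist_norm)
      also have "Lf \<le> Lf / lam 0 * lam k"
        using l0 Lf_pos by (simp add: field_simps)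
      finally show ?thesis by (simp add: mult_right_mono)
    qed
    have gab: "norm (?m i a *\<^sub>R gradient (g i) a - ?m i b *\<^sub>R gradient (g i) b) \<le> N i * lam k * ?n" for i
    proof -
      have "?m i a *\<^sub>R gradient (g i) a - ?m i b *\<^sub>R gradient (g i) b
          = (?m i a - ?m i b) *\<^sub>R gradient (g i) a + ?m i b *\<^sub>R (gradient (g i) a - gradient (g i) b)"
        by (simp add: algebra_simps)
      also have "norm \<dots> \<le> \<bar>?m i a - ?m i b\<bar> * norm (gradient (g i) a)
          + ?m i b * norm (gradient (g i) a - gradient (g i) b)"
        by (rule norm_triangle_le) simp
      also have "\<bar>?m i a - ?m i b\<bar> * norm (gradient (g i) a) \<le> (lam k * (B * ?n)) * B"
      proof (rule mult_mono)
        have "\<bar>max (p + s) 0 - max (q + s) 0\<bar> \<le> \<bar>p - q\<bar>" for p q s :: real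
          by (auto simp: max_def abs_if)
        then have "\<bar>?m i a - ?m i b\<bar> \<le> \<bar>lam k * g i a - lam k * g i b\<bar>" .
        also have "\<dots> = lam k * \<bar>g i a - g i b\<bar>"
          using l0 by (simp add: right_diff_distrib[symmetric] abs_mult)
        also have "\<dots> \<le> lam k * (B * ?n)"
          using B(4)[OF ab] l0 by (intro mult_left_mono) auto
        finally show "\<bar>?m i a - ?m i b\<bar> \<le> lam k * (B * ?n)" .
      qed (use B(1) B(2)[OF ab(1)] l0 in auto)
      also have "?m i b * norm (gradient (g i) a - gradient (g i) b) \<le> (lam k * (B + Z / lam 0)) * (Lg i * ?n)"
      proof (rule mult_mono)
        have "lam k * g i b \<le> lam k * B"
          using B(3)[OF ab(2), of i] l0 by (intro mult_left_mono) auto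
        moreover have "z k $ i \<le> lam k * (Z / lam 0)"
        proof -
          have "Z \<le> lam k * (Z / lam 0)" using l0 Z(1) by (simp add: field_simps)
          then show ?thesis using Z(2)[of k i] by linarith
        qed
        moreover have "0 \<le> lam k * B" "0 \<le> lam k * (Z / lam 0)" using B(1) Z(1) l0 by auto
        ultimately show "?m i b \<le> lam k * (B + Z / lam 0)" by (simp add: distrib_left)
        show "norm (gradient (g i) a - gradient (g i) b) \<le> Lg i * ?n"
          using lipschitz_onD[OF g_smooth[unfolded edom_Ind] ab, of i] by (simp add: dist_norm)
      qed (use B(1) Z(1) l0 in auto)
      finally show ?thesis by (simp add: N_def algebra_simps)
    qed
    have "norm (al_gradient f g (lam k) (z k) a - al_gradient f g (lam k) (z k) b)
        \<le> norm (gradient f a - gradient f b)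
          + (\<Sum>i\<in>UNIV. norm (?m i a *\<^sub>R gradient (g i) a - ?m i b *\<^sub>R gradient (g i) b))"
      unfolding al_gradient_def add_diff_add sum_subtractf[symmetric]
      by (intro norm_triangle_le add_left_mono norm_sum)
    also have "\<dots> \<le> Lf / lam 0 * lam k * ?n + (\<Sum>i\<in>UNIV. N i * lam k * ?n)"
      using fab gab by (intro add_mono sum_mono)
    also have "\<dots> = M * lam k * ?n"
      by (simp add: M_def distrib_right sum_distrib_right)
    finally show "norm (al_gradient f g (lam k) (z k) a - al_gradient f g (lam k) (z k) b) \<le> M * lam k * ?n" .
  qed
qed

section \<open>The saddle point and the one-step inequality\<close>

lemma kkt_saddle:
  obtains xs and y :: "real^'m" where "xs \<in> C" "\<And>i. g i xs \<le> 0" "\<And>i. y $ i \<ge> 0"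
    "opt_value f (Ind C) g = ereal (f xs)"
    "\<And>w. w \<in> C \<Longrightarrow> f xs - (\<Sum>i\<in>UNIV. y $ i * g i w) \<le> f w"
proof -
  obtain xs y s where
    s: "s \<in> subdifferential (Ind C) xs" "0 = gradient f xs + s + (\<Sum>i\<in>UNIV. y $ i *\<^sub>R gradient (g i) xs)"
    and feas: "\<And>i. g i xs \<le> 0" and y: "\<And>i. y $ i \<ge> 0" and comp: "(\<Sum>i\<in>UNIV. y $ i * g i xs) = 0"
    using kkt_exists unfolding kkt_point_def by auto
  have sub: "Ind C w \<ge> Ind C xs + ereal (s \<bullet> (w - xs))" for w
    using s(1) unfolding subdifferential_def by blast
  \<comment> \<open>Outside \<open>C\<close> the left end of the subgradient inequality at
    \<open>x 0\<close> would be 0 and the right end infinite.\<close>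
  have xs: "xs \<in> C"
    using sub[of "x 0"] x_in_C[of 0] by (auto simp: Ind_def split: if_splits)
  \<comment> \<open>Stationarity is paired with \<open>w - xs\<close>: the subgradient of the
    indicator contributes a nonpositive term, \<open>f\<close> and each \<open>g i\<close> lie above
    their tangents, and complementarity removes the values at \<open>xs\<close>.\<close>
  have saddle: "f xs - (\<Sum>i\<in>UNIV. y $ i * g i w) \<le> f w" if "w \<in> C" for w
  proof -
    have "s \<bullet> (w - xs) \<le> 0" using sub[of w] that xs by (simp add: Ind_def)
    moreover have "0 = (gradient f xs + s + (\<Sum>i\<in>UNIV. y $ i *\<^sub>R gradient (g i) xs)) \<bullet> (w - xs)"
      unfolding s(2)[symmetric] by simp
    then have "0 = gradient f xs \<bullet> (w - xs) + s \<bullet> (w - xs) + (\<Sum>i\<in>UNIV. y $ i * (gradient (g i) xs \<bullet> (w - xs)))"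
      by (simp add: inner_add_left inner_sum_left)
    moreover have "(\<Sum>i\<in>UNIV. y $ i * (gradient (g i) xs \<bullet> (w - xs))) \<le> (\<Sum>i\<in>UNIV. y $ i * (g i w - g i xs))"
    proof (intro sum_mono mult_left_mono y)
      show "gradient (g i) xs \<bullet> (w - xs) \<le> g i w - g i xs" for i
        using convex_gradient_ineq[OF g_convex g_diff, of i xs w] by simp
    qed
    moreover have "\<dots> = (\<Sum>i\<in>UNIV. y $ i * g i w)"
      using comp by (simp add: right_diff_distrib sum_subtractf)
    ultimately show ?thesis using convex_gradient_ineq[OF f_convex f_diff, of xs w] by linarith
  qed
  have opt: "opt_value f (Ind C) g = ereal (f xs)"
    unfolding opt_value_def
  proof (rule antisym)
    show "(INF w\<in>{w. \<forall>i. g i w \<le> 0}. ereal (f w) + Ind C w) \<le> ereal (f xs)"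
      using feas xs by (intro INF_lower2[of xs]) (auto simp: Ind_def)
    show "ereal (f xs) \<le> (INF w\<in>{w. \<forall>i. g i w \<le> 0}. ereal (f w) + Ind C w)"
    proof (rule INF_greatest)
      fix w assume w: "w \<in> {w. \<forall>i. g i w \<le> 0}"
      have "(\<Sum>i\<in>UNIV. y $ i * g i w) \<le> 0"
        using w y by (intro sum_nonpos) (auto simp: mult_nonneg_nonpos)
      then show "ereal (f xs) \<le> ereal (f w) + Ind C w"
        using saddle[of w] by (auto simp: Ind_def)
    qed
  qed
  from xs feas y opt saddle show ?thesis by (rule that)
qed

text \<open>The gap bound is convexity at the optimal point, where \<Psi> is nonpositive. The
  recursion is a Frank-Wolfe step with fixed parameters followed by the parameter update, whose cost
  \<open>\<Psi>_update\<close> and the residual bound express through the current value.\<close>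

lemma one_step:
  obtains L M B where "opt_value f (Ind C) g = ereal L" "M > 0" "B > 0"
    "\<And>k. max (val k - L) 0 \<le> gap k"
    "\<And>k. max (val (Suc k) - L) 0 \<le> (1 + drift k)
        * max (max (val k - L) 0 - \<alpha> k * gap k + \<alpha> k * (M * lam k * \<alpha> k) * (norm (v k - x k))\<^sup>2) 0
        + drift k * B / lam k"
    "\<And>k. (\<Sum>i\<in>UNIV. (residual g (lam k) (x k) (z k) i)\<^sup>2) \<le> 4 / lam k * (max (val k - L) 0 + B / lam k)"
proof -
  obtain xs and y :: "real^'m" where xs: "xs \<in> C" "\<And>i. g i xs \<le> 0" and y: "\<And>i. y $ i \<ge> 0"
    and opt: "opt_value f (Ind C) g = ereal (f xs)"
    and saddle: "\<And>w. w \<in> C \<Longrightarrow> f xs - (\<Sum>i\<in>UNIV. y $ i * g i w) \<le> f w"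
    by (rule kkt_saddle[OF that])
  obtain M where M: "M > 0" "\<And>k a b. a \<in> C \<Longrightarrow> b \<in> C \<Longrightarrow>
      norm (al_gradient f g (lam k) (z k) a - al_gradient f g (lam k) (z k) b) \<le> M * lam k * norm (a - b)"
    by (rule direction_lipschitz[OF that])
  obtain Z where Z: "Z > 0" "\<And>k i. z k $ i \<le> Z" by (rule z_bounded[OF that])
  define L where "L = f xs"
  define B where "B = 1 + (\<Sum>i\<in>(UNIV :: 'm set). (Z + y $ i)\<^sup>2)"
  have B: "B > 0" unfolding B_def by (intro add_pos_nonneg sum_nonneg) auto
  have zB: "(\<Sum>i\<in>UNIV. (z k $ i - y $ i)\<^sup>2) \<le> B" for k
  proof -
    have "(z k $ i - y $ i)\<^sup>2 \<le> (Z + y $ i)\<^sup>2" for i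
    proof -
      have "\<bar>z k $ i - y $ i\<bar> \<le> \<bar>Z + y $ i\<bar>"
        using z_nonneg[of k i] Z(2)[of k i] y[of i] by simp
      then show ?thesis by (simp only: abs_le_square_iff)
    qed
    then have "(\<Sum>i\<in>UNIV. (z k $ i - y $ i)\<^sup>2) \<le> (\<Sum>i\<in>UNIV. (Z + y $ i)\<^sup>2)" by (rule sum_mono)
    then show ?thesis by (simp add: B_def)
  qed
  have residual_bound: "(\<Sum>i\<in>UNIV. (residual g (lam k) w (z k) i)\<^sup>2)
      \<le> 4 / lam k * (F_AL f g (lam k) w (z k) - L + B / lam k)" if "w \<in> C" for k w
  proof -
    have "(\<Sum>i\<in>UNIV. (residual g (lam k) w (z k) i)\<^sup>2)
      \<le> 4 / lam k * (F_AL f g (lam k) w (z k) - L + (\<Sum>i\<in>UNIV. (z k $ i - y $ i)\<^sup>2) / lam k)"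
      using lam_pos y saddle[OF that] unfolding L_def by (intro residual_sq_le)
    also have "\<dots> \<le> 4 / lam k * (F_AL f g (lam k) w (z k) - L + B / lam k)"
      using zB lam_pos[of k] by (intro mult_left_mono add_left_mono divide_right_mono) auto
    finally show ?thesis .
  qed
  have gap_val: "max (val k - L) 0 \<le> gap k" for k
  proof -
    have "val k + direction k \<bullet> (xs - x k) \<le> F_AL f g (lam k) xs (z k)"
      unfolding val_def direction_def
      by (intro F_AL_above_tangent f_convex f_diff g_convex g_diff lam_pos)
    also have "\<dots> \<le> L"
      using \<Psi>_nonpos[where g = g, OF lam_pos xs(2)] by (simp add: F_AL_def L_def)
    finally have "val k - L \<le> direction k \<bullet> (x k - xs)" by (simp add: inner_diff_right)
    \<comment> \<open>The competitor \<open>x k\<close> itself shows that the gap is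
      nonnegative.\<close>
    with gap_ge[OF xs(1), of k] gap_ge[OF x_in_C, of k k] show ?thesis by simp
  qed
  have step: "max (val (Suc k) - L) 0 \<le> (1 + drift k)
        * max (max (val k - L) 0 - \<alpha> k * gap k + \<alpha> k * (M * lam k * \<alpha> k) * (norm (v k - x k))\<^sup>2) 0
        + drift k * B / lam k" (is "_ \<le> (1 + drift k) * max ?X 0 + _") for k
  proof -
    define H where "H = F_AL f g (lam k) (x (Suc k)) (z k) - L"
    let ?G = "al_gradient f g (lam k) (z k)"
    let ?r = "\<Sum>i\<in>UNIV. (residual g (lam k) (x (Suc k)) (z k) i)\<^sup>2"
    have d: "x (Suc k) - x k = \<alpha> k *\<^sub>R (v k - x k)" by (simp add: x_step)
    have "?G (x (Suc k)) \<bullet> (x (Suc k) - x k)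
        = direction k \<bullet> (x (Suc k) - x k) + (?G (x (Suc k)) - ?G (x k)) \<bullet> (x (Suc k) - x k)"
      by (simp add: direction_def inner_diff_left)
    also have "direction k \<bullet> (x (Suc k) - x k) = - \<alpha> k * gap k"
      by (simp add: d gap_def inner_diff_right algebra_simps)
    also have "(?G (x (Suc k)) - ?G (x k)) \<bullet> (x (Suc k) - x k)
        \<le> norm (?G (x (Suc k)) - ?G (x k)) * norm (x (Suc k) - x k)"
      by (rule norm_cauchy_schwarz)
    also have "\<dots> \<le> M * lam k * norm (x (Suc k) - x k) * norm (x (Suc k) - x k)"
      using M(2)[OF x_in_C x_in_C] by (intro mult_right_mono) auto
    also have "\<dots> = \<alpha> k * (M * lam k * \<alpha> k) * (norm (v k - x k))\<^sup>2"
      using \<alpha>_range[of k] by (simp add: d power2_eq_square)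
    finally have G: "?G (x (Suc k)) \<bullet> (x (Suc k) - x k)
        \<le> - \<alpha> k * gap k + \<alpha> k * (M * lam k * \<alpha> k) * (norm (v k - x k))\<^sup>2" by simp
    \<comment> \<open>The tangent is taken at the new point, so descent follows from convexity; the
      gradient change, bounded in \<open>G\<close>, is the price.\<close>
    have "F_AL f g (lam k) (x (Suc k)) (z k) + ?G (x (Suc k)) \<bullet> (x k - x (Suc k)) \<le> val k"
      unfolding val_def by (intro F_AL_above_tangent f_convex f_diff g_convex g_diff lam_pos)
    then have "H \<le> val k - L + ?G (x (Suc k)) \<bullet> (x (Suc k) - x k)"
      by (simp add: H_def inner_diff_right)
    with G have "H \<le> max ?X 0" by linarith
    then have HX: "(1 + drift k) * H \<le> (1 + drift k) * max ?X 0"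
      using drift_nonneg[of k] by (intro mult_left_mono) auto
    have "val (Suc k) - L \<le> H + ((lam (Suc k) - lam k) / 2 + \<sigma> k) * ?r"
      using \<Psi>_update[OF lam_pos lam_pos z_step_residual, of "Suc k" k]
      by (simp add: H_def val_def F_AL_def)
    also have "((lam (Suc k) - lam k) / 2 + \<sigma> k) * ?r
        \<le> ((lam (Suc k) - lam k) / 2 + \<sigma> k) * (4 / lam k * (H + B / lam k))"
      unfolding H_def using residual_bound[OF x_in_C] strict_monoD[OF lam_strict_mono, of k "Suc k"] \<sigma>_pos[of k]
      by (intro mult_left_mono) auto
    also have "\<dots> = drift k * (H + B / lam k)"
      using lam_pos[of k] by (simp add: drift_def field_simps)
    finally have "val (Suc k) - L \<le> (1 + drift k) * max ?X 0 + drift k * B / lam k"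
      using HX by (simp add: algebra_simps)
    moreover have "0 \<le> (1 + drift k) * max ?X 0 + drift k * B / lam k"
      using drift_nonneg[of k] B lam_pos[of k] by (intro add_nonneg_nonneg mult_nonneg_nonneg divide_nonneg_pos) auto
    ultimately show ?thesis by simp
  qed
  have res: "(\<Sum>i\<in>UNIV. (residual g (lam k) (x k) (z k) i)\<^sup>2) \<le> 4 / lam k * (max (val k - L) 0 + B / lam k)" for k
  proof (rule order.trans[OF residual_bound[OF x_in_C]])
    show "4 / lam k * (F_AL f g (lam k) (x k) (z k) - L + B / lam k) \<le> 4 / lam k * (max (val k - L) 0 + B / lam k)"
      unfolding val_def using lam_pos[of k] by (intro mult_left_mono) auto
  qed
  have "opt_value f (Ind C) g = ereal L" using opt by (simp add: L_def)
  from this M(1) B gap_val step res show ?thesis by (rule that)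
qed

text \<open>Once the residual is small, the multipliers \<open>[\<lambda>\<^sub>k g + z]\<^sub>+\<close> form an admissible pair with \<open>x k\<close>.\<close>

lemma direction_lower_bound:
  assumes "\<epsilon> > 0"
    and A: "\<And>w y. (w, y) \<in> \<A> g \<epsilon> \<Longrightarrow> w \<in> C \<Longrightarrow>
      c \<le> norm (gradient f w + (\<Sum>i\<in>UNIV. y $ i *\<^sub>R gradient (g i) w))"
    and res: "(\<lambda>k. \<Sum>i\<in>UNIV. (residual g (lam k) (x k) (z k) i)\<^sup>2) \<longlonglongrightarrow> 0"
  shows "\<forall>\<^sub>F k in sequentially. c \<le> norm (direction k)"
proof -
  obtain Z where Z: "Z > 0" "\<And>k i. z k $ i \<le> Z" by (rule z_bounded[OF that])
  have "\<forall>\<^sub>F k in sequentially. (\<Sum>i\<in>UNIV. (residual g (lam k) (x k) (z k) i)\<^sup>2) < \<epsilon>\<^sup>2"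
    using res by (rule order_tendstoD) (use assms(1) in simp)
  \<comment> \<open>With this threshold \<open>g i (x k) < - \<epsilon>\<close> forces
    \<open>lam k * g i (x k) + z k $ i \<le> 0\<close>, so the corresponding entry of
    \<open>y\<close> below vanishes.\<close>
  moreover have "\<forall>\<^sub>F k in sequentially. Z / \<epsilon> \<le> lam k"
    using lam_at_top by (simp add: filterlim_at_top)
  ultimately show ?thesis
  proof eventually_elim
    case (elim k)
    define y :: "real^'m" where "y = (\<chi> i. max (lam k * g i (x k) + z k $ i) 0)"
    have "(x k, y) \<in> \<A> g \<epsilon>"
      unfolding \<A>_def
    proof (intro CollectI case_prodI conjI allI impI)
      fix i
      show "0 \<le> y $ i" by (simp add: y_def)
      have "(residual g (lam k) (x k) (z k) i)\<^sup>2 \<le> (\<Sum>i\<in>UNIV. (residual g (lam k) (x k) (z k) i)\<^sup>2)"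
        by (rule member_le_sum) auto
      also have "\<dots> \<le> \<epsilon>\<^sup>2" using elim(1) by (rule less_imp_le)
      finally have "residual g (lam k) (x k) (z k) i \<le> \<epsilon>"
        by (rule power2_le_imp_le) (use assms(1) in simp)
      then show "g i (x k) \<le> \<epsilon>" by (simp add: residual_def)
      assume "g i (x k) < - \<epsilon>"
      then have "lam k * g i (x k) \<le> lam k * (- \<epsilon>)"
        using lam_pos[of k] by (intro mult_left_mono) auto
      moreover have "Z \<le> lam k * \<epsilon>" using elim(2) assms(1) by (simp add: pos_divide_le_eq)
      ultimately show "y $ i = 0" using Z(2)[of k i] by (simp add: y_def)
    qed
    from A[OF this x_in_C] show ?case
      by (simp add: direction_def al_gradient_def y_def)
  qed
qed

lemma T_eq:
  assumes "opt_value f (Ind C) g = ereal L"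
  shows "max (aug_lagrangian f (Ind C) g (lam k) (x k) (z k) - opt_value f (Ind C) g) 0
    = ereal (max (val k - L) 0)"
proof -
  have "aug_lagrangian f (Ind C) g (lam k) (x k) (z k) - opt_value f (Ind C) g = ereal (val k - L)"
    using x_in_C[of k] by (simp add: assms aug_lagrangian_def Ind_def val_def)
  then show ?thesis by (simp add: max_def)
qed

end

subsection \<open>The convergence rate\<close>

theorem proposition5p2:
  fixes f :: "real^'n \<Rightarrow> real"
    and h :: "real^'n \<Rightarrow> ereal"
    and g :: "'m::finite \<Rightarrow> real^'n \<Rightarrow> real"
    and Lf D :: real and Lg :: "'m \<Rightarrow> real"
    and C :: "(real^'n) set"
    and \<nu> q \<epsilon> \<tau> p \<gamma> \<mu> \<omega> :: real
    and lam \<sigma> \<alpha> :: "nat \<Rightarrow> real"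
    and x v :: "nat \<Rightarrow> real^'n"
    and z :: "nat \<Rightarrow> real^'m"
    and T :: "nat \<Rightarrow> ereal"
  assumes program: "convex_program f h g Lf D Lg"
    and h_Ind: "h = Ind C"
    and C_compact: "compact C"
    and \<nu>: "\<nu> > 0" and q: "q \<ge> 2"
    and C_uniformly_convex: "uniformly_convex_set \<nu> q C"
    and \<epsilon>: "\<epsilon> > 0"
    and gradient_bound:
      "(INF (x, z)\<in>{(x, z). (x, z) \<in> \<A> g \<epsilon> \<and> x \<in> C}.
          ereal (norm (gradient f x + (\<Sum>i\<in>UNIV. (z $ i) *\<^sub>R gradient (g i) x)))) > 0"
    and algorithm: "fw_alm f h g lam \<sigma> \<alpha> x v z"
    and \<tau>: "0 < \<tau>" "\<tau> < 1"
    and lam_rate: "lam \<in> \<Theta>(\<lambda>k. real k powr \<tau>)"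
    and lam_diff: "(\<lambda>k. lam (Suc k) - lam k) \<in> O(\<lambda>k. real k powr (- (1 - \<tau>)))"
    and p: "\<tau> < p" "p < 1"
    and \<alpha>_range: "\<And>k. 0 < \<alpha> k \<and> \<alpha> k \<le> 1"
    and \<alpha>_noninc: "decseq \<alpha>"
    and \<alpha>_rate: "\<alpha> \<in> \<Theta>(\<lambda>k. real k powr (- p))"
    and \<gamma>: "\<gamma> > 0"
    and \<sigma>_rate: "\<sigma> \<in> \<Theta>(\<lambda>k. real k powr (- (1 + \<gamma>)))"
    and T: "\<And>k. T k = max (aug_lagrangian f h g (lam k) (x k) (z k) - opt_value f h g) 0"
    and \<mu>: "\<mu> = 1 - 2 / q"
    and \<omega>: "\<omega> = min (p - \<tau>) (1 - p + \<tau>)"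
  shows "\<exists>t :: nat \<Rightarrow> real. (\<forall>k. T k = ereal (t k)) \<and>
    (\<mu> = 0 \<longrightarrow> t \<in> O(\<lambda>k. 1 / real k powr (1 - p + \<tau>))) \<and>
    (0 < \<mu> \<and> \<mu> < 1 \<longrightarrow>
       t \<in> O(\<lambda>k. max (1 / real k powr ((1 - \<mu>) * \<omega> + p - \<tau>)) (1 / real k powr (1 - p + \<tau>))))"
proof -
  have \<alpha>_pos: "0 < \<alpha> k" for k using \<alpha>_range by blast
  interpret indicator_fw_alm f C g Lf D Lg lam \<sigma> \<alpha> x v z
    using program algorithm C_compact C_uniformly_convex
    by (simp add: h_Ind indicator_fw_alm_def indicator_fw_alm_axioms_def uniformly_convex_set_def)
  obtain L M B where opt: "opt_value f (Ind C) g = ereal L" and M: "M > 0" and B: "B > 0"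
    and gap: "\<And>k. max (val k - L) 0 \<le> gap k"
    and step: "\<And>k. max (val (Suc k) - L) 0 \<le> (1 + drift k)
        * max (max (val k - L) 0 - \<alpha> k * gap k + \<alpha> k * (M * lam k * \<alpha> k) * (norm (v k - x k))\<^sup>2) 0
        + drift k * B / lam k"
    and res: "\<And>k. (\<Sum>i\<in>UNIV. (residual g (lam k) (x k) (z k) i)\<^sup>2)
        \<le> 4 / lam k * (max (val k - L) 0 + B / lam k)"
    by (rule one_step[OF that])
  define t where "t k = max (val k - L) 0" for k
  define \<theta> where "\<theta> k = M * lam k * \<alpha> k" for k
  define n where "n k = norm (v k - x k)" for k
  have \<theta>0: "\<theta> k \<ge> 0" for k
    using M lam_pos[of k] \<alpha>_pos[of k] by (simp add: \<theta>_def)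
  have n: "0 \<le> n k" "n k \<le> D" for k
    using h_diam[of "v k" "x k"] v_in_C x_in_C by (auto simp: n_def edom_Ind)

  \<comment> \<open>Decay of the parameter drift\<close>
  obtain l l' where l: "l > 0" "l' > 0"
    "\<forall>\<^sub>F k in sequentially. l * real k powr \<tau> \<le> lam k \<and> lam k \<le> l' * real k powr \<tau>"
    by (rule bigtheta_powr_bounds[OF lam_rate less_imp_le[OF lam_pos] that])
  obtain a a' where a: "a > 0" "a' > 0"
    "\<forall>\<^sub>F k in sequentially. a * real k powr (- p) \<le> \<alpha> k \<and> \<alpha> k \<le> a' * real k powr (- p)"
    by (rule bigtheta_powr_bounds[OF \<alpha>_rate less_imp_le[OF \<alpha>_pos] that])
  obtain s s' where s: "s > 0" "s' > 0"
    "\<forall>\<^sub>F k in sequentially. s * real k powr (- (1 + \<gamma>)) \<le> \<sigma> k \<and> \<sigma> k \<le> s' * real k powr (- (1 + \<gamma>))"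
    by (rule bigtheta_powr_bounds[OF \<sigma>_rate less_imp_le[OF \<sigma>_pos] that])
  obtain d where d: "d > 0"
    "\<forall>\<^sub>F k in sequentially. norm (lam (Suc k) - lam k) \<le> d * norm (real k powr (- (1 - \<tau>)))"
    by (rule landau_o.bigE[OF lam_diff that])
  \<comment> \<open>The increments of \<open>lam\<close> and \<sigma> are both of order at most
    \<open>real k powr (\<tau> - 1)\<close>; division by \<open>lam k\<close> leaves 1/k.\<close>
  define N where "N = (2 * d + 4 * s') / l"
  have drift_rate: "\<forall>\<^sub>F k in sequentially. drift k \<le> N * real k powr (- 1)"
    using l(3) s(3) d(2) eventually_gt_at_top[of 0]
  proof eventually_elim
    case (elim k)
    let ?y = "real k powr (- (1 - \<tau>))"
    have "s' * real k powr (- (1 + \<gamma>)) \<le> s' * ?y"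
      using s(2) \<gamma> \<tau> by (intro mult_left_mono real_powr_mono) auto
    then have "\<sigma> k \<le> s' * ?y" using conjunct2[OF elim(2)] by (rule order.trans[rotated])
    moreover have "lam (Suc k) - lam k \<le> d * ?y"
      using elim by (simp add: abs_le_iff)
    ultimately have "2 * (lam (Suc k) - lam k) + 4 * \<sigma> k \<le> 2 * (d * ?y) + 4 * (s' * ?y)"
      by (intro add_mono mult_left_mono) auto
    also have "\<dots> = (2 * d + 4 * s') * ?y" by (simp only: distrib_right mult.assoc)
    finally have "2 * (lam (Suc k) - lam k) + 4 * \<sigma> k \<le> (2 * d + 4 * s') * ?y" .
    then have "drift k \<le> ((2 * d + 4 * s') * ?y) / (l * real k powr \<tau>)"
      unfolding drift_def using elim l(1) d(1) s(2) by (intro frac_le) auto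
    also have "\<dots> = N * (?y / real k powr \<tau>)"
      by (simp add: N_def)
    also have "?y / real k powr \<tau> = real k powr (- 1)"
      by (simp only: powr_diff[symmetric]) simp
    finally show ?case .
  qed
  have N: "N > 0" unfolding N_def using d(1) s(2) l(1) by simp
  define N' where "N' = max N (N * B / l)"
  \<comment> \<open>The forcing term has order \<open>- 1 - \<tau>\<close>. Splitting off the
    exponent \<open>- p\<close> of the stepsize leaves \<open>1 - p + \<tau>\<close>, the rate that
    caps the final estimate.\<close>
  have b_rate: "\<forall>\<^sub>F k in sequentially. drift k * B / lam k \<le> N' * real k powr (- p - (1 - p + \<tau>))"
    using l(3) drift_rate eventually_gt_at_top[of 0]
  proof eventually_elim
    case (elim k)
    have "drift k * B / lam k \<le> (N * real k powr (- 1)) * B / (l * real k powr \<tau>)"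
      using elim l(1) B N drift_nonneg[of k] by (intro frac_le mult_right_mono) auto
    also have "\<dots> = N * B / l * (real k powr (- 1) / real k powr \<tau>)" by simp
    also have "real k powr (- 1) / real k powr \<tau> = real k powr (- p - (1 - p + \<tau>))"
      by (simp only: powr_diff[symmetric]) simp
    also have "N * B / l * \<dots> \<le> N' * real k powr (- p - (1 - p + \<tau>))"
      by (intro mult_right_mono) (auto simp: N'_def)
    finally show ?case .
  qed

  \<comment> \<open>From curvature estimates to rates of \<open>t\<close>\<close>
  have rate: "t \<in> O(\<lambda>k. real k powr (- r))"
    if r: "0 \<le> r" "r \<le> 1 - p + \<tau>" and R: "R \<ge> 0"
      "\<forall>\<^sub>F k in sequentially. \<theta> k * (n k)\<^sup>2 \<le> gap k / 2 + R * real k powr (- r)" for r R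
  proof (rule rate_from_gap[where gp = gap and e = drift and E = "\<lambda>k. \<theta> k * (n k)\<^sup>2"
        and b = "\<lambda>k. drift k * B / lam k" and N = N' and \<alpha> = \<alpha>, OF _ _ _ drift_nonneg _ _ a(1,3) _ R p(2) r(1)])
    show "t (Suc k) \<le> (1 + drift k) * max (t k - \<alpha> k * gap k + \<alpha> k * (\<theta> k * (n k)\<^sup>2)) 0
        + drift k * B / lam k" for k
      using step[of k] by (simp add: t_def \<theta>_def n_def mult.assoc)
    show "\<forall>\<^sub>F k in sequentially. drift k \<le> N' * real k powr (- 1)"
      using drift_rate
    proof eventually_elim
      case (elim k)
      have "N * real k powr (- 1) \<le> N' * real k powr (- 1)"
        by (intro mult_right_mono) (auto simp: N'_def)
      with elim show ?case by linarith
    qed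
    show "\<forall>\<^sub>F k in sequentially. drift k * B / lam k \<le> N' * real k powr (- p - r)"
      using b_rate
    proof eventually_elim
      case (elim k)
      have "N' * real k powr (- p - (1 - p + \<tau>)) \<le> N' * real k powr (- p - r)"
        using r N by (intro mult_left_mono real_powr_mono) (auto simp: N'_def)
      with elim show ?case by linarith
    qed
  qed (use gap \<alpha>_range in \<open>auto simp: t_def intro: less_imp_le\<close>)
  define \<theta>\<^sub>0 where "\<theta>\<^sub>0 = M * l' * a'"
  have \<theta>\<^sub>0: "\<theta>\<^sub>0 > 0" unfolding \<theta>\<^sub>0_def using M l(2) a(2) by simp
  have \<theta>_rate: "\<forall>\<^sub>F k in sequentially. \<theta> k \<le> \<theta>\<^sub>0 * real k powr (- (p - \<tau>))"
    using l(3) a(3)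
  proof eventually_elim
    case (elim k)
    have "\<theta> k \<le> M * (l' * real k powr \<tau>) * (a' * real k powr (- p))"
      unfolding \<theta>_def using elim M l(2) \<alpha>_pos[of k] lam_pos[of k]
      by (intro mult_mono mult_left_mono) (auto intro: less_imp_le)
    also have "\<dots> = \<theta>\<^sub>0 * (real k powr \<tau> * real k powr (- p))" by (simp add: \<theta>\<^sub>0_def)
    also have "\<dots> = \<theta>\<^sub>0 * real k powr (- (p - \<tau>))" by (simp only: powr_add[symmetric]) simp
    finally show ?case .
  qed
  \<comment> \<open>Rate 0 means boundedness of \<open>t\<close>; the diameter bound on
    \<open>n k\<close> suffices because \<theta> is eventually at most
    \<open>\<theta>\<^sub>0\<close>.\<close>
  have "t \<in> O(\<lambda>k. real k powr (- 0))"
  proof (rule rate[where R = "\<theta>\<^sub>0 * D\<^sup>2"])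
    show "\<forall>\<^sub>F k in sequentially. \<theta> k * (n k)\<^sup>2 \<le> gap k / 2 + \<theta>\<^sub>0 * D\<^sup>2 * real k powr (- 0)"
      using \<theta>_rate eventually_gt_at_top[of 0]
    proof eventually_elim
      case (elim k)
      have "\<theta>\<^sub>0 * real k powr (- (p - \<tau>)) \<le> \<theta>\<^sub>0 * real k powr 0"
        using \<theta>\<^sub>0 p by (intro mult_left_mono real_powr_mono) auto
      then have "\<theta> k \<le> \<theta>\<^sub>0" using elim by simp
      then have "\<theta> k * (n k)\<^sup>2 \<le> \<theta>\<^sub>0 * D\<^sup>2"
        using \<theta>0 n \<theta>\<^sub>0 by (intro mult_mono power_mono) auto
      moreover have "0 \<le> gap k" using gap[of k] by simp
      ultimately show ?case using elim by simp
    qed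
  qed (use p \<tau> \<theta>\<^sub>0 in auto)
  then obtain K where K: "K > 0" "\<forall>\<^sub>F k in sequentially. norm (t k) \<le> K * norm (real k powr (- 0))"
    by (rule landau_o.bigE) auto
  have "(\<lambda>k. \<Sum>i\<in>UNIV. (residual g (lam k) (x k) (z k) i)\<^sup>2) \<longlonglongrightarrow> 0"
  proof (rule Lim_null_comparison)
    have inv: "(\<lambda>k. c / lam k) \<longlonglongrightarrow> 0" for c
      by (rule tendsto_divide_0[OF tendsto_const]) (rule filterlim_at_top_imp_at_infinity[OF lam_at_top])
    have "(\<lambda>k. 4 / lam k * (K + B / lam k)) \<longlonglongrightarrow> 0 * (K + 0)"
      by (intro tendsto_mult tendsto_add inv tendsto_const)
    then show "(\<lambda>k. 4 / lam k * (K + B / lam k)) \<longlonglongrightarrow> 0" by simp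
    show "\<forall>\<^sub>F k in sequentially. norm (\<Sum>i\<in>UNIV. (residual g (lam k) (x k) (z k) i)\<^sup>2)
        \<le> 4 / lam k * (K + B / lam k)"
      using K(2) eventually_gt_at_top[of 0]
    proof eventually_elim
      case (elim k)
      have "t k \<le> K" using elim by simp
      then have "4 / lam k * (t k + B / lam k) \<le> 4 / lam k * (K + B / lam k)"
        using lam_pos[of k] by (intro mult_left_mono) auto
      moreover have "0 \<le> (\<Sum>i\<in>UNIV. (residual g (lam k) (x k) (z k) i)\<^sup>2)" by (intro sum_nonneg) auto
      ultimately show ?case using res[of k] unfolding t_def by simp
    qed
  qed
  moreover obtain c where c: "c > 0" "\<And>w y. (w, y) \<in> \<A> g \<epsilon> \<Longrightarrow> w \<in> C \<Longrightarrow>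
      c \<le> norm (gradient f w + (\<Sum>i\<in>UNIV. y $ i *\<^sub>R gradient (g i) w))"
  \<comment> \<open>The infimum may be infinite, so a positive real strictly below it is
    chosen.\<close>
  proof -
    obtain c where c: "0 < ereal c" "ereal c < (INF (x, z)\<in>{(x, z). (x, z) \<in> \<A> g \<epsilon> \<and> x \<in> C}.
          ereal (norm (gradient f x + (\<Sum>i\<in>UNIV. (z $ i) *\<^sub>R gradient (g i) x))))"
      using ereal_dense2[OF gradient_bound] by blast
    show ?thesis
    proof (rule that)
      fix w y assume "(w, y) \<in> \<A> g \<epsilon>" "w \<in> C"
      then show "c \<le> norm (gradient f w + (\<Sum>i\<in>UNIV. y $ i *\<^sub>R gradient (g i) w))"
        using less_INF_D[OF c(2), of "(w, y)"] by simp
    qed (use c(1) in simp)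
  qed
  ultimately have direction: "\<forall>\<^sub>F k in sequentially. c \<le> norm (direction k)"
    using \<epsilon> by (intro direction_lower_bound)
  define \<kappa> where "\<kappa> = \<nu> / 2 * c"
  have \<kappa>: "\<kappa> > 0" using \<nu> c(1) by (simp add: \<kappa>_def)
  have gap_powr: "\<forall>\<^sub>F k in sequentially. \<kappa> * n k powr q \<le> gap k"
    using direction
  proof eventually_elim
    case (elim k)
    have "\<kappa> * n k powr q \<le> \<nu> / 2 * norm (direction k) * n k powr q"
      unfolding \<kappa>_def using elim \<nu> by (intro mult_right_mono mult_left_mono) auto
    also have "\<dots> \<le> gap k"
      unfolding gap_def n_def norm_minus_commute[of "v k"]
      using C_uniformly_convex \<nu> x_in_C v_in_C v_linear_min by (intro uniformly_convex_linear_gap)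
    finally show ?case .
  qed
  have "\<forall>k. T k = ereal (t k)"
    using T T_eq[OF opt] by (simp add: h_Ind t_def)
  moreover have "t \<in> O(\<lambda>k. 1 / real k powr (1 - p + \<tau>))" if "\<mu> = 0"
  proof -
    \<comment> \<open>Curvature term and gap bound are now both quadratic in \<open>n k\<close>.
      Since \<theta> tends to 0, half of the gap eventually absorbs the curvature and no error
      remains, so \<open>R = 0\<close>.\<close>
    have "q = 2" using that \<mu> q by (simp add: field_simps)
    have "\<forall>\<^sub>F k in sequentially. \<theta>\<^sub>0 * real k powr (- (p - \<tau>)) < \<kappa> / 2"
      using powr_neg_tendsto_0[of "p - \<tau>" \<theta>\<^sub>0] p \<kappa> by (intro order_tendstoD(2)) auto
    with \<theta>_rate gap_powr
    have "\<forall>\<^sub>F k in sequentially. \<theta> k * (n k)\<^sup>2 \<le> gap k / 2 + 0 * real k powr (- (1 - p + \<tau>))"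
    proof eventually_elim
      case (elim k)
      have "n k powr q = (n k)\<^sup>2" using n(1)[of k] by (cases "n k = 0") (auto simp: \<open>q = 2\<close>)
      then have "\<kappa> / 2 * (n k)\<^sup>2 \<le> gap k / 2" using elim(2) by simp
      moreover have "\<theta> k * (n k)\<^sup>2 \<le> \<kappa> / 2 * (n k)\<^sup>2"
        using order.trans[OF elim(1) less_imp_le[OF elim(3)]] by (rule mult_right_mono) simp
      ultimately show ?case by simp
    qed
    then have "t \<in> O(\<lambda>k. real k powr (- (1 - p + \<tau>)))"
      using p \<tau> by (intro rate[where R = 0]) auto
    then show ?thesis by (simp only: powr_minus_divide)
  qed
  moreover have "t \<in> O(\<lambda>k. max (1 / real k powr ((1 - \<mu>) * \<omega> + p - \<tau>)) (1 / real k powr (1 - p + \<tau>)))"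
    if \<mu>01: "0 < \<mu>" "\<mu> < 1"
  proof -
    have "q > 2" using that \<mu> q by (cases "q = 2") auto
    \<comment> \<open>The slower of the Young error and the parameter drift.\<close>
    define r where "r = min ((p - \<tau>) / \<mu>) (1 - p + \<tau>)"
    define R where "R = \<theta>\<^sub>0 * (2 * \<theta>\<^sub>0 / \<kappa>) powr (2 / (q - 2))"
    have R: "R \<ge> 0" using \<theta>\<^sub>0 by (simp add: R_def)
    have r: "0 \<le> r" "r \<le> 1 - p + \<tau>" using p \<tau> \<mu>01 by (auto simp: r_def)
    have "\<forall>\<^sub>F k in sequentially. \<theta> k * (n k)\<^sup>2 \<le> gap k / 2 + R * real k powr (- r)"
      using \<theta>_rate gap_powr
    proof eventually_elim
      case (elim k)
      have "\<theta> k * (n k)\<^sup>2 \<le> \<kappa> / 2 * n k powr q + R * real k powr (- ((p - \<tau>) / \<mu>))"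
        unfolding R_def using n(1) \<theta>0 elim \<kappa> \<open>q > 2\<close> \<theta>\<^sub>0 \<mu> by (intro square_le_powr_rate) auto
      also have "\<dots> \<le> gap k / 2 + R * real k powr (- r)"
        using elim R by (intro add_mono mult_left_mono real_powr_mono) (auto simp: r_def)
      finally show ?case .
    qed
    then have t_rate: "t \<in> O(\<lambda>k. real k powr (- r))" using r R by (intro rate)
    have "(1 - \<mu>) * \<omega> + (p - \<tau>) \<le> (p - \<tau>) / \<mu>"
    proof -
      have "(1 - \<mu>) * \<omega> \<le> (1 - \<mu>) * (p - \<tau>)" using \<mu>01 by (intro mult_left_mono) (auto simp: \<omega>)
      \<comment> \<open>Multiplied by \<mu>, the comparison of the factors is
        \<open>(1 - \<mu>)^2 \<ge> 0\<close>.\<close>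
      moreover have "(2 - \<mu>) * (p - \<tau>) \<le> 1 / \<mu> * (p - \<tau>)"
      proof (rule mult_right_mono)
        have "0 \<le> (1 - \<mu>)\<^sup>2" by simp
        then show "2 - \<mu> \<le> 1 / \<mu>" using \<mu>01 by (simp add: power2_eq_square field_simps)
      qed (use p in simp)
      ultimately show ?thesis by (simp add: algebra_simps)
    qed
    then have "- r \<le> - ((1 - \<mu>) * \<omega> + p - \<tau>) \<or> - r = - (1 - p + \<tau>)"
      by (auto simp: r_def min_def)
    then have "real k powr (- r) \<le> real k powr (- ((1 - \<mu>) * \<omega> + p - \<tau>))
        \<or> real k powr (- r) = real k powr (- (1 - p + \<tau>))" for k
      using real_powr_mono by metis
    then have "real k powr (- r)
        \<le> max (1 / real k powr ((1 - \<mu>) * \<omega> + p - \<tau>)) (1 / real k powr (1 - p + \<tau>))" for k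
      unfolding powr_minus_divide le_max_iff_disj by (metis order.refl)
    then have "(\<lambda>k. real k powr (- r))
        \<in> O(\<lambda>k. max (1 / real k powr ((1 - \<mu>) * \<omega> + p - \<tau>)) (1 / real k powr (1 - p + \<tau>)))"
      by (intro bigoI[where c = 1] always_eventually) (auto intro: order.trans[OF _ abs_ge_self])
    with t_rate show ?thesis by (rule landau_o.big_trans)
  qed
  ultimately show ?thesis by blast
qed

end
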